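(* Assume the Continuum Hypothesis. Let $\rho_i:\mathcal{F}_i\to[\Lambda_i]^\omega$ be partition regular functions for $i=1,2$. If $\rho_1$ is weak $P^+$ and has small accretions, then the following conditions are equivalent: (1) $\rho_2\not\leq_K\rho_1$. (2) There exists a separable topological space $X$ with unique limits of sequences such that $X\in\mathrm{FinBW}(\rho_1)\setminus\mathrm{FinBW}(\rho_2)$.
   Context: Topological spaces are not assumed Hausdorff. $[A]^\omega$ is the family of infinite countable subsets of $A$, $[A]^{<\omega}$ the family of finite subsets of $A$. Partition regular functions: let $\Lambda,\Omega$ be countably infinite, and let $\mathcal{F}$ be a nonempty family of infinite subsets of $\Omega$ such that $F\setminus K\in\mathcal{F}$ for all $F\in\mathcal{F}$ and finite $K\subseteq\Omega$. A function $\rho:\mathcal{F}\to[\Lambda]^\omega$ is partition regular if (M) for all $E,F\in\mathcal{F}$, $E\subseteq F$ implies $\rho(E)\subseteq\rho(F)$; (R) for all $F\in\mathcal{F}$ and $A,B\subseteq\Lambda$ with $\rho(F)=A\cup B$ there is $E\in\mathcal{F}$ with $\rho(E)\subseteq A$ or $\rho(E)\subseteq B$; (S) for every $F\in\mathcal{F}$ there is $E\in\mathcal{F}$ with $E\subseteq F$ such that for every $a\in\rho(E)$ there is a finite $K\subseteq\Omega$ with $a\notin\rho(E\setminus K)$. Put $\mathcal{I}_\rho=\{A\subseteq\Lambda:\forall F\in\mathcal{F}\ \rho(F)\not\subseteq A\}$ (an ideal on $\Lambda$). For $F\in\mathcal{F}$ and $B\subseteq\Lambda$ write $\rho(F)\subseteq^\rho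 B$ if there is a finite $K\subseteq\Omega$ with $\rho(F\setminus K)\subseteq B$. $\rho$ is weak $P^+$ if for every $E\in\mathcal{F}$ there is $F\in\mathcal{F}$ with $\rho(F)\subseteq\rho(E)$ such that for every sequence $(F_n)_{n\in\omega}$ in $\mathcal{F}$ with $\rho(F)\supseteq\rho(F_n)\supseteq\rho(F_{n+1})$ for all $n$ there is $G\in\mathcal{F}$ with $\rho(G)\subseteq^\rho\rho(F_n)$ for all $n$. $F\in\mathcal{F}$ has small accretions if $\rho(F)\setminus\rho(F\setminus K)\in\mathcal{I}_\rho$ for every finite $K\subseteq\Omega$; $\rho$ has small accretions if every $E\in\mathcal{F}$ contains some $F\in\mathcal{F}$, $F\subseteq E$, with small accretions. Katětov order for partition regular $\rho_i:\mathcal{F}_i\to[\Lambda_i]^\omega$, $\mathcal{F}_i\subseteq[\Omega_i]^\omega$: $\rho_2\leq_K\rho_1$ if there is $\phi:\Lambda_1\to\Lambda_2$ such that $\forall F_1\in\mathcal{F}_1\,\exists F_2\in\mathcal{F}_2\,\forall K_1\in[\Omega_1]^{<\omega}\,\exists K_2\in[\Omega_2]^{<\omega}\ \rho_2(F_2\setminus K_2)\subseteq\phi[\rho_1(F_1\setminus K_1)]$. For $F\in\mathcal{F}$, $f:\rho(F)\to X$ is $\rho$-convergent to $x\in X$ if for every neighbourhood $U$ of $x$ there is a finite $K\subseteq\Omega$ with $f[\rho(F\setminus K)]\subseteq U$. $\mathrm{FinBW}(\rho)$ is the class of all topological spaces $X$ such that for every $f:\Lambda\to X$ there is $F\in\mathcal{F}$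 such that $f\restriction\rho(F)$ is $\rho$-convergent to some point of $X$. *)

theory Defs
  imports "HOL-Analysis.Analysis"
begin

definition continuum_hypothesis :: bool where
  "continuum_hypothesis \<longleftrightarrow>
     (\<forall>S :: real set. countable S \<or> S \<approx> (UNIV :: real set))"

text \<open>
  The map \<open>\<rho>\<close> is a total function on subsets of the type \<open>'o\<close>; only its values on the family
  \<open>\<F>\<close> are relevant, and all conditions below are restricted to members of \<open>\<F>\<close>.
  Members of \<open>\<F>\<close> and their images are automatically countable, being subsets of \<open>\<Omega>\<close> and \<open>\<Lambda>\<close>.
\<close>

definition partition_regular ::
  "'l set \<Rightarrow> 'o set \<Rightarrow> 'o set set \<Rightarrow> ('o set \<Rightarrow> 'l set) \<Rightarrow> bool" where
  "partition_regular \<Lambda> \<Omega> \<F> \<rho> \<longleftrightarrow>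
     countable \<Lambda> \<and> infinite \<Lambda> \<and> countable \<Omega> \<and> infinite \<Omega> \<and>
     \<F> \<noteq> {} \<and>
     (\<forall>F\<in>\<F>. F \<subseteq> \<Omega> \<and> infinite F) \<and>
     (\<forall>F\<in>\<F>. \<forall>K. K \<subseteq> \<Omega> \<and> finite K \<longrightarrow> F - K \<in> \<F>) \<and>
     (\<forall>F\<in>\<F>. \<rho> F \<subseteq> \<Lambda> \<and> infinite (\<rho> F)) \<and>
     (\<forall>E\<in>\<F>. \<forall>F\<in>\<F>. E \<subseteq> F \<longrightarrow> \<rho> E \<subseteq> \<rho> F) \<and>
     (\<forall>F\<in>\<F>. \<forall>A B. A \<subseteq> \<Lambda> \<and> B \<subseteq> \<Lambda> \<and> \<rho> F = A \<union> B \<longrightarrow>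
        (\<exists>E\<in>\<F>. \<rho> E \<subseteq> A \<or> \<rho> E \<subseteq> B)) \<and>
     (\<forall>F\<in>\<F>. \<exists>E\<in>\<F>. E \<subseteq> F \<and>
        (\<forall>a\<in>\<rho> E. \<exists>K. K \<subseteq> \<Omega> \<and> finite K \<and> a \<notin> \<rho> (E - K)))"

definition ideal_of ::
  "'l set \<Rightarrow> 'o set set \<Rightarrow> ('o set \<Rightarrow> 'l set) \<Rightarrow> 'l set set" where
  "ideal_of \<Lambda> \<F> \<rho> = {A. A \<subseteq> \<Lambda> \<and> (\<forall>F\<in>\<F>. \<not> \<rho> F \<subseteq> A)}"

definition almost_subset ::
  "'o set \<Rightarrow> ('o set \<Rightarrow> 'l set) \<Rightarrow> 'o set \<Rightarrow> 'l set \<Rightarrow> bool" where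
  "almost_subset \<Omega> \<rho> F B \<longleftrightarrow> (\<exists>K. K \<subseteq> \<Omega> \<and> finite K \<and> \<rho> (F - K) \<subseteq> B)"

definition weak_P_plus ::
  "'o set \<Rightarrow> 'o set set \<Rightarrow> ('o set \<Rightarrow> 'l set) \<Rightarrow> bool" where
  "weak_P_plus \<Omega> \<F> \<rho> \<longleftrightarrow>
     (\<forall>E\<in>\<F>. \<exists>F\<in>\<F>. \<rho> F \<subseteq> \<rho> E \<and>
        (\<forall>S :: nat \<Rightarrow> 'o set.
           (\<forall>n. S n \<in> \<F> \<and> \<rho> (S n) \<subseteq> \<rho> F \<and> \<rho> (S (Suc n)) \<subseteq> \<rho> (S n)) \<longrightarrow>
           (\<exists>G\<in>\<F>. \<forall>n. almost_subset \<Omega> \<rho> G (\<rho> (S n)))))"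

definition set_has_small_accretions ::
  "'l set \<Rightarrow> 'o set \<Rightarrow> 'o set set \<Rightarrow> ('o set \<Rightarrow> 'l set) \<Rightarrow> 'o set \<Rightarrow> bool" where
  "set_has_small_accretions \<Lambda> \<Omega> \<F> \<rho> F \<longleftrightarrow>
     (\<forall>K. K \<subseteq> \<Omega> \<and> finite K \<longrightarrow> \<rho> F - \<rho> (F - K) \<in> ideal_of \<Lambda> \<F> \<rho>)"

definition has_small_accretions ::
  "'l set \<Rightarrow> 'o set \<Rightarrow> 'o set set \<Rightarrow> ('o set \<Rightarrow> 'l set) \<Rightarrow> bool" where
  "has_small_accretions \<Lambda> \<Omega> \<F> \<rho> \<longleftrightarrow>
     (\<forall>E\<in>\<F>. \<exists>F\<in>\<F>. F \<subseteq> E \<and> set_has_small_accretions \<Lambda> \<Omega> \<F> \<rho> F)"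

text \<open>The first group of arguments is the smaller function: \<open>\<rho>\<^sub>2 \<le>\<^sub>K \<rho>\<^sub>1\<close>.\<close>

definition katetov_le ::
  "'l2 set \<Rightarrow> 'o2 set \<Rightarrow> 'o2 set set \<Rightarrow> ('o2 set \<Rightarrow> 'l2 set) \<Rightarrow>
   'l1 set \<Rightarrow> 'o1 set \<Rightarrow> 'o1 set set \<Rightarrow> ('o1 set \<Rightarrow> 'l1 set) \<Rightarrow> bool" where
  "katetov_le \<Lambda>\<^sub>2 \<Omega>\<^sub>2 \<F>\<^sub>2 \<rho>\<^sub>2 \<Lambda>\<^sub>1 \<Omega>\<^sub>1 \<F>\<^sub>1 \<rho>\<^sub>1 \<longleftrightarrow>
     (\<exists>\<phi> \<in> \<Lambda>\<^sub>1 \<rightarrow> \<Lambda>\<^sub>2. \<forall>F\<^sub>1\<in>\<F>\<^sub>1. \<exists>F\<^sub>2\<in>\<F>\<^sub>2.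
        \<forall>K\<^sub>1. K\<^sub>1 \<subseteq> \<Omega>\<^sub>1 \<and> finite K\<^sub>1 \<longrightarrow>
          (\<exists>K\<^sub>2. K\<^sub>2 \<subseteq> \<Omega>\<^sub>2 \<and> finite K\<^sub>2 \<and> \<rho>\<^sub>2 (F\<^sub>2 - K\<^sub>2) \<subseteq> \<phi> ` \<rho>\<^sub>1 (F\<^sub>1 - K\<^sub>1)))"

definition rho_convergent ::
  "'o set \<Rightarrow> ('o set \<Rightarrow> 'l set) \<Rightarrow> 'o set \<Rightarrow> 'x topology \<Rightarrow> ('l \<Rightarrow> 'x) \<Rightarrow> 'x \<Rightarrow> bool" where
  "rho_convergent \<Omega> \<rho> F X f x \<longleftrightarrow>
     x \<in> topspace X \<and>
     (\<forall>U. openin X U \<and> x \<in> U \<longrightarrow>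
        (\<exists>K. K \<subseteq> \<Omega> \<and> finite K \<and> f ` \<rho> (F - K) \<subseteq> U))"

definition FinBW ::
  "'l set \<Rightarrow> 'o set \<Rightarrow> 'o set set \<Rightarrow> ('o set \<Rightarrow> 'l set) \<Rightarrow> 'x topology set" where
  "FinBW \<Lambda> \<Omega> \<F> \<rho> =
     {X. \<forall>f \<in> \<Lambda> \<rightarrow> topspace X. \<exists>F\<in>\<F>. \<exists>x. rho_convergent \<Omega> \<rho> F X f x}"

definition unique_sequential_limits :: "'x topology \<Rightarrow> bool" where
  "unique_sequential_limits X \<longleftrightarrow>
     (\<forall>(s :: nat \<Rightarrow> 'x) a b. range s \<subseteq> topspace X \<and>
        limitin X s a sequentially \<and> limitin X s b sequentially \<longrightarrow> a = b)"

end

theory Submission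
  imports Defs
begin

text \<open>
  The sets \<open>\<rho>(F - K)\<close> with \<open>K\<close> finite form a countable filter base. In terms of the filters they
  generate, \<open>\<rho>\<close>-convergence is ordinary convergence along a filter, and \<open>\<phi>\<close> witnesses
  \<open>\<rho>\<^sub>2 \<le>\<^sub>K \<rho>\<^sub>1\<close> iff the image under \<open>\<phi>\<close> of every filter of \<open>\<rho>\<^sub>1\<close> is coarser than some filter of \<open>\<rho>\<^sub>2\<close>.
  Hence \<open>\<rho>\<^sub>2 \<le>\<^sub>K \<rho>\<^sub>1\<close> implies \<open>FinBW(\<rho>\<^sub>1) \<subseteq> FinBW(\<rho>\<^sub>2)\<close>.

  Conversely, the space consists of \<open>\<Lambda>\<^sub>2\<close> (isolated points), at most continuum many further points,
  and one point at infinity. By CH the maps \<open>h : \<Lambda>\<^sub>1 \<rightarrow> \<Lambda>\<^sub>2\<close> are enumerated in a well-order with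
  countable initial segments. If \<open>h\<close> is not already constant or convergent to an earlier point along
  some filter of \<open>\<rho>\<^sub>1\<close>, a new point is added whose neighbourhood filter is the image under \<open>h\<close> of such
  a filter. Starting from the set \<open>E\<close> at which \<open>h\<close> fails to be a Katetov reduction, small accretions
  allow one to thin out into every \<open>\<rho>\<^sub>1(E - K)\<close>, and weak \<open>P\<^sup>+\<close> yields a single filter meeting
  countably many demands: refining the filter of \<open>E\<close> (so no filter of \<open>\<rho>\<^sub>2\<close> converges to the new
  point), and separating the new point from all points of \<open>\<Lambda>\<^sub>2\<close> and all earlier ones. Maps into the
  set of added points become constant or finite-to-one, and in the second case converge to infinity.
  Removing an added point together with a sequence in \<open>\<Lambda>\<^sub>2\<close> converging to it leaves a neighbourhood
  of infinity; this gives unique sequential limits, although the space need not be Hausdorff. It also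
  prevents \<open>\<rho>\<^sub>2\<close>-convergence to infinity, because every infinite subset of \<open>\<Lambda>\<^sub>2\<close> contains a sequence
  converging to an added point.
\<close>

section \<open>Filters with a countable base\<close>

definition countably_generated :: "'a filter \<Rightarrow> bool" where
  "countably_generated F \<longleftrightarrow>
     (\<exists>\<B>. countable \<B> \<and> (\<forall>P. eventually P F \<longleftrightarrow> (\<exists>B\<in>\<B>. \<forall>x\<in>B. P x)))"

lemma countably_generatedI:
  assumes "countable \<B>" "\<And>P. eventually P F \<longleftrightarrow> (\<exists>B\<in>\<B>. \<forall>x\<in>B. P x)"
  shows "countably_generated F"
  using assms unfolding countably_generated_def by blast

lemma countably_generated_principal: "countably_generated (principal A)"
  by (rule countably_generatedI[of "{A}"]) (simp_all add: eventually_principal)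

lemma countably_generated_filtermap:
  assumes "countably_generated F"
  shows "countably_generated (filtermap f F)"
proof -
  obtain \<B> where \<B>: "countable \<B>" "\<And>P. eventually P F \<longleftrightarrow> (\<exists>B\<in>\<B>. \<forall>x\<in>B. P x)"
    using assms unfolding countably_generated_def by blast
  show ?thesis
    by (rule countably_generatedI[of "image f ` \<B>"]) (simp_all add: \<B> eventually_filtermap)
qed

definition all_members_infinite :: "'a filter \<Rightarrow> bool" where
  "all_members_infinite F \<longleftrightarrow> (\<forall>A. (\<forall>\<^sub>F x in F. x \<in> A) \<longrightarrow> infinite A)"

lemma all_members_infinite_neq_bot: "all_members_infinite F \<Longrightarrow> F \<noteq> bot"
  unfolding all_members_infinite_def by (metis eventually_bot finite.emptyI)

lemma all_members_infinite_filtermap: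
  assumes "all_members_infinite F" "\<forall>\<^sub>F x in F. x \<in> A" "inj_on f A"
  shows "all_members_infinite (filtermap f F)"
  unfolding all_members_infinite_def eventually_filtermap
proof (intro allI impI notI)
  fix B assume "\<forall>\<^sub>F x in F. f x \<in> B" and "finite B"
  from this(1) assms(2) have "\<forall>\<^sub>F x in F. x \<in> f -` B \<inter> A"
    by eventually_elim simp
  moreover have "finite (f -` B \<inter> A)"
    using \<open>finite B\<close> assms(3) by (rule finite_vimage_IntI)
  ultimately show False
    using assms(1) unfolding all_members_infinite_def by blast
qed

lemma injective_choice:
  fixes A :: "nat \<Rightarrow> 'a set"
  assumes "\<And>n. infinite (A n)"
  obtains c where "inj c" "\<And>n. c n \<in> A n"
proof -
  have "\<exists>c. \<forall>n. c n \<in> A n \<and> c n \<notin> c ` {..<n}"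
  proof (rule dependent_wf_choice[OF wf_less_than])
    fix c c' :: "nat \<Rightarrow> 'a" and n r assume "\<And>m. (m, n) \<in> less_than \<Longrightarrow> c m = c' m"
    then have "c ` {..<n} = c' ` {..<n}" by (intro image_cong) auto
    then show "(r \<in> A n \<and> r \<notin> c ` {..<n}) = (r \<in> A n \<and> r \<notin> c' ` {..<n})" by simp
  next
    fix n and c :: "nat \<Rightarrow> 'a"
    have "infinite (A n - c ` {..<n})" using assms by (simp add: Diff_infinite_finite)
    then have "A n - c ` {..<n} \<noteq> {}" by (metis finite.emptyI)
    then show "\<exists>r. r \<in> A n \<and> r \<notin> c ` {..<n}" by blast
  qed
  then obtain c where c: "\<And>n. c n \<in> A n" "\<And>n. c n \<notin> c ` {..<n}" by blast
  have "c m \<noteq> c n" if "m < n" for m n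
    using c(2)[of n] that by (metis image_eqI lessThan_iff)
  then have "inj c" by (rule linorder_injI)
  with c(1) show thesis by (rule that[rotated])
qed

definition almost_contained :: "'a set \<Rightarrow> 'a filter \<Rightarrow> bool" where
  "almost_contained C F \<longleftrightarrow> (\<forall>A. (\<forall>\<^sub>F x in F. x \<in> A) \<longrightarrow> finite (C - A))"

lemma almost_contained_subset: "almost_contained C F \<Longrightarrow> B \<subseteq> C \<Longrightarrow> almost_contained B F"
  unfolding almost_contained_def by (meson Diff_mono finite_subset order_refl)

lemma almost_contained_mono: "almost_contained C F \<Longrightarrow> F \<le> G \<Longrightarrow> almost_contained C G"
  unfolding almost_contained_def by (blast intro: filter_leD)

lemma infinite_almost_contained_set_exists:
  assumes "countably_generated F" "all_members_infinite F" "\<forall>\<^sub>F x in F. x \<in> A"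
  obtains C where "infinite C" "C \<subseteq> A" "almost_contained C F"
proof -
  obtain \<B> where \<B>: "countable \<B>" "\<And>P. eventually P F \<longleftrightarrow> (\<exists>B\<in>\<B>. \<forall>x\<in>B. P x)"
    using assms(1) unfolding countably_generated_def by blast
  have "\<B> \<noteq> {}" using \<B>(2)[of "\<lambda>_. True"] by auto
  define b where "b = from_nat_into \<B>"
  have "\<forall>\<^sub>F x in F. x \<in> b k" for k
    using \<B>(2) from_nat_into[OF \<open>\<B> \<noteq> {}\<close>, of k] unfolding b_def by blast
  then have "\<forall>\<^sub>F x in F. x \<in> (\<Inter>k\<le>n. b k)" for n
    by (simp add: eventually_ball_finite)
  then have "infinite (\<Inter>k\<le>n. b k)" for n
    using assms(2) unfolding all_members_infinite_def by blast
  then obtain c where "inj c" and c: "\<And>n. c n \<in> (\<Inter>k\<le>n. b k)"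
    using injective_choice[of "\<lambda>n. \<Inter>k\<le>n. b k"] by blast
  have "finite (range c - A')" if A': "\<forall>\<^sub>F x in F. x \<in> A'" for A'
  proof -
    obtain B where "B \<in> \<B>" "B \<subseteq> A'" using A' unfolding \<B>(2) by blast
    then obtain k where k: "b k \<subseteq> A'"
      using from_nat_into_surj[OF \<B>(1)] unfolding b_def by blast
    have "range c - A' \<subseteq> c ` {..<k}"
      using c k by (fastforce simp: not_le[symmetric])
    then show ?thesis by (rule finite_subset) simp
  qed
  then have C: "almost_contained (range c) F" unfolding almost_contained_def by blast
  show thesis
  proof (rule that)
    have "infinite (range c)" using \<open>inj c\<close> by (simp add: finite_image_iff)
    moreover have "finite (range c - A)" using C assms(3) unfolding almost_contained_def by blast
    moreover have "range c \<subseteq> range c \<inter> A \<union> (range c - A)" by blast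
    ultimately show "infinite (range c \<inter> A)" using finite_UnI finite_subset by blast
    show "almost_contained (range c \<inter> A) F" using C by (rule almost_contained_subset) simp
  qed simp
qed

lemma inf_eq_bot_iff: "inf F G = bot \<longleftrightarrow> (\<exists>A. (\<forall>\<^sub>F x in F. x \<notin> A) \<and> (\<forall>\<^sub>F x in G. x \<in> A))"
proof
  assume "inf F G = bot"
  then have "\<forall>\<^sub>F x in inf F G. False" by simp
  then obtain P Q where "eventually P F" "eventually Q G" "\<And>x. \<not> (P x \<and> Q x)"
    unfolding eventually_inf by blast
  then show "\<exists>A. (\<forall>\<^sub>F x in F. x \<notin> A) \<and> (\<forall>\<^sub>F x in G. x \<in> A)"
    by (intro exI[of _ "Collect Q"]) (auto elim: eventually_mono)
next
  assume "\<exists>A. (\<forall>\<^sub>F x in F. x \<notin> A) \<and> (\<forall>\<^sub>F x in G. x \<in> A)"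
  then have "\<forall>\<^sub>F x in inf F G. False" unfolding eventually_inf by blast
  then show "inf F G = bot" by (simp add: eventually_False)
qed

lemma filterlim_cofiniteI:
  fixes f :: "'a \<Rightarrow> 'b"
  assumes "\<And>x. \<forall>\<^sub>F a in F. f a \<noteq> x"
  shows "filterlim f cofinite F"
  unfolding filterlim_iff eventually_cofinite
proof (intro allI impI)
  fix P :: "'b \<Rightarrow> bool" assume "finite {x. \<not> P x}"
  then have "\<forall>\<^sub>F a in F. \<forall>x\<in>{x. \<not> P x}. f a \<noteq> x"
    using assms by (intro eventually_ball_finite) simp_all
  then show "\<forall>\<^sub>F a in F. P (f a)" by (rule eventually_mono) blast
qed

lemma le_cofinite_if_disjoint_from_points:
  assumes "F \<le> principal N" "\<forall>x\<in>N. inf F (principal {x}) = bot"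
  shows "F \<le> cofinite"
proof -
  have "\<forall>\<^sub>F y in F. y \<noteq> x" for x
  proof (cases "x \<in> N")
    case True
    then have "\<forall>\<^sub>F y in inf F (principal {x}). False" using assms(2) by simp
    then show ?thesis by (simp add: eventually_inf_principal)
  next
    case False
    then show ?thesis using assms(1) unfolding le_principal by (auto elim: eventually_mono)
  qed
  then show ?thesis using filterlim_cofiniteI[of "\<lambda>y. y" F] by (simp add: filterlim_def)
qed

lemma filtermap_cong:
  assumes "\<forall>\<^sub>F x in F. f x = g x"
  shows "filtermap f F = filtermap g F"
  unfolding filter_eq_iff eventually_filtermap
  using assms by (intro allI eventually_cong) (auto elim: eventually_mono)

lemma limitin_mono: "limitin X f x F \<Longrightarrow> G \<le> F \<Longrightarrow> limitin X f x G"
  unfolding limitin_def by (blast intro: filter_leD)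

lemma limitin_filtermap: "limitin X f x (filtermap g F) \<longleftrightarrow> limitin X (\<lambda>a. f (g a)) x F"
  by (simp add: limitin_def eventually_filtermap)

section \<open>Greedy recursion under the Continuum Hypothesis\<close>

lemma continuum_hypothesis_countable_or_eqpoll:
  assumes continuum_hypothesis "S \<lesssim> (UNIV :: real set)"
  shows "countable S \<or> S \<approx> (UNIV :: real set)"
proof -
  obtain k :: "_ \<Rightarrow> real" where k: "inj_on k S" using assms(2) unfolding lepoll_def by blast
  have "countable (k ` S) \<or> k ` S \<approx> (UNIV :: real set)"
    using assms(1) unfolding continuum_hypothesis_def by blast
  then show ?thesis
    using countable_image_inj_on[OF _ k] inj_on_image_eqpoll_1[OF k] by blast
qed

lemma continuum_hypothesis_well_order:
  fixes S :: "'s set"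
  assumes continuum_hypothesis "S \<lesssim> (UNIV :: real set)"
  obtains R where "wf R" "R \<subseteq> S \<times> S" "total_on S R" "\<And>s. countable {t. (t, s) \<in> R}"
proof (rule that)
  let ?r = "card_of S"
  have "well_order_on S ?r" by (rule card_of_well_order_on)
  then show "wf (?r - Id)" "total_on S (?r - Id)"
    by (auto simp: well_order_on_def linear_order_on_def total_on_def)
  show R: "?r - Id \<subseteq> S \<times> S"
    using Field_card_of[of S] by (auto simp: Field_def)
  show "countable {t. (t, s) \<in> ?r - Id}" for s
  proof (cases "s \<in> S")
    case True
    let ?U = "underS ?r s"
    have "?U \<lesssim> S"
      using R unfolding underS_def by (intro subset_imp_lepoll) blast
    have "(card_of ?U, ?r) \<in> ordLess"
      using True by (intro card_of_underS[OF card_of_Card_order]) (simp add: Field_card_of)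
    then have "\<not> ?U \<approx> S" unfolding eqpoll_iff_card_of_ordIso by (simp add: not_ordLess_ordIso)
    moreover have "?U \<approx> S" if "?U \<approx> (UNIV :: real set)"
      using \<open>?U \<lesssim> S\<close> lepoll_trans2[OF assms(2) eqpoll_sym[OF that]] by (rule lepoll_antisym)
    ultimately have "countable ?U"
      using continuum_hypothesis_countable_or_eqpoll[OF assms(1) lepoll_trans[OF \<open>?U \<lesssim> S\<close> assms(2)]]
      by blast
    then show ?thesis by (rule countable_subset[rotated]) (auto simp: underS_def)
  next
    case False
    then have "{t. (t, s) \<in> ?r - Id} = {}" using R by blast
    then show ?thesis by (simp only: countable_empty)
  qed
qed

lemma greedy_choice_exists:
  fixes solves :: "'d \<Rightarrow> 's \<Rightarrow> bool" and compatible :: "'d \<Rightarrow> 'd \<Rightarrow> bool"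
  assumes R: "wf R" "R \<subseteq> S \<times> S" "\<And>s. countable {t. (t, s) \<in> R}"
    and step: "\<And>Q s. \<lbrakk>s \<in> S; countable Q; \<forall>d\<in>Q. good d\<rbrakk> \<Longrightarrow>
      \<exists>d. good d \<and> solves d s \<and> (d \<in> Q \<or> (\<forall>d'\<in>Q. compatible d d'))"
  obtains f where "\<And>s. s \<in> S \<Longrightarrow> good (f s) \<and> solves (f s) s \<and>
    (f s \<in> f ` {t. (t, s) \<in> R} \<or> (\<forall>d\<in>f ` {t. (t, s) \<in> R}. compatible (f s) d))"
proof -
  define choice where "choice f s d \<longleftrightarrow> (s \<in> S \<longrightarrow> good d \<and> solves d s \<and>
      (d \<in> f ` {t. (t, s) \<in> R} \<or> (\<forall>d'\<in>f ` {t. (t, s) \<in> R}. compatible d d')))"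
    for f :: "'s \<Rightarrow> 'd" and s d
  have "\<exists>f. \<forall>s. choice f s (f s)"
  proof (rule dependent_wf_choice[OF R(1)])
    fix f g :: "'s \<Rightarrow> 'd" and s d assume "\<And>t. (t, s) \<in> R \<Longrightarrow> f t = g t"
    then have "f ` {t. (t, s) \<in> R} = g ` {t. (t, s) \<in> R}" by (intro image_cong) auto
    then show "choice f s d = choice g s d" unfolding choice_def by simp
  next
    fix s f assume prev: "\<And>t. (t, s) \<in> R \<Longrightarrow> choice f t (f t)"
    have "\<forall>d\<in>f ` {t. (t, s) \<in> R}. good d"
      using prev R(2) unfolding choice_def by blast
    then show "\<exists>d. choice f s d"
      using step[of s "f ` {t. (t, s) \<in> R}"] R(3) unfolding choice_def by blast
  qed
  then obtain f where "\<And>s. choice f s (f s)" by blast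
  then show thesis unfolding choice_def by (intro that[of f]) blast
qed

lemma greedy_choice_pairwise:
  assumes R: "wf R" "R \<subseteq> S \<times> S" "total_on S R" and symp: "symp compatible"
    and f: "\<And>s. s \<in> S \<Longrightarrow>
      f s \<in> f ` {t. (t, s) \<in> R} \<or> (\<forall>d\<in>f ` {t. (t, s) \<in> R}. compatible (f s) d)"
  shows "pairwise compatible (f ` S)"
proof -
  have below: "f t = f s \<or> compatible (f s) (f t)" if "(t, s) \<in> R" for s t
    using R(1) that
  proof (induction s arbitrary: t)
    case (less s)
    have "s \<in> S" using less.prems R(2) by blast
    then consider "compatible (f s) (f t)" | u where "(u, s) \<in> R" "f s = f u"
      using f[of s] less.prems by blast
    then show ?case
    proof cases
      case 2
      then have "u = t \<or> (u, t) \<in> R \<or> (t, u) \<in> R"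
        using less.prems R(2,3) unfolding total_on_def by blast
      then show ?thesis
        using less.IH[OF less.prems, of u] less.IH[OF 2(1), of t] 2(2) symp
        by (auto dest: sympD)
    qed simp
  qed
  show ?thesis
  proof (rule pairwise_imageI)
    fix s t assume "s \<in> S" "t \<in> S" "s \<noteq> t" "f s \<noteq> f t"
    moreover from this have "(s, t) \<in> R \<or> (t, s) \<in> R" using R(3) unfolding total_on_def by blast
    ultimately show "compatible (f s) (f t)" using below symp by (metis sympD)
  qed
qed

lemma continuum_hypothesis_greedy_family:
  fixes S :: "'s set" and solves :: "'d \<Rightarrow> 's \<Rightarrow> bool" and compatible :: "'d \<Rightarrow> 'd \<Rightarrow> bool"
  assumes CH: continuum_hypothesis and S: "S \<lesssim> (UNIV :: real set)" and symp: "symp compatible"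
    and step: "\<And>Q s. \<lbrakk>s \<in> S; countable Q; \<forall>d\<in>Q. good d\<rbrakk> \<Longrightarrow>
      \<exists>d. good d \<and> solves d s \<and> (d \<in> Q \<or> (\<forall>d'\<in>Q. compatible d d'))"
  obtains Q where "Q \<lesssim> (UNIV :: real set)" "\<forall>d\<in>Q. good d" "pairwise compatible Q"
    "\<forall>s\<in>S. \<exists>d\<in>Q. solves d s"
proof -
  obtain R where R: "wf R" "R \<subseteq> S \<times> S" "total_on S R" "\<And>s. countable {t. (t, s) \<in> R}"
    using continuum_hypothesis_well_order[OF CH S] by blast
  obtain f where f: "\<And>s. s \<in> S \<Longrightarrow> good (f s) \<and> solves (f s) s \<and>
      (f s \<in> f ` {t. (t, s) \<in> R} \<or> (\<forall>d\<in>f ` {t. (t, s) \<in> R}. compatible (f s) d))"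
    using greedy_choice_exists[of R S good solves compatible, OF R(1,2,4) step] by blast
  show thesis
  proof (rule that)
    show "f ` S \<lesssim> (UNIV :: real set)" using image_lepoll S by (rule lepoll_trans)
    show "\<forall>d\<in>f ` S. good d" "\<forall>s\<in>S. \<exists>d\<in>f ` S. solves d s" using f by blast+
    show "pairwise compatible (f ` S)" using R(1-3) symp f by (intro greedy_choice_pairwise) blast+
  qed
qed

lemma countable_functions_lepoll_real:
  assumes "countable A" "countable B"
  shows "(A \<rightarrow>\<^sub>E B) \<lesssim> (UNIV :: real set)"
proof -
  have "inj_on (\<lambda>f. (\<lambda>a. (a, f a)) ` A) (A \<rightarrow>\<^sub>E B)"
  proof (rule inj_onI)
    fix f g assume fg: "f \<in> A \<rightarrow>\<^sub>E B" "g \<in> A \<rightarrow>\<^sub>E B" "(\<lambda>a. (a, f a)) ` A = (\<lambda>a. (a, g a)) ` A"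
    show "f = g" using fg(3) by (intro PiE_ext[OF fg(1,2)]) blast
  qed
  then have "(A \<rightarrow>\<^sub>E B) \<lesssim> Pow (A \<times> B)"
    unfolding lepoll_def by (intro exI conjI, assumption) auto
  also have "Pow (A \<times> B) \<lesssim> (UNIV :: nat set set)"
    using assms unfolding lepoll_def
    by (intro exI[of _ "image (to_nat_on (A \<times> B))"])
       (simp add: inj_on_image_Pow inj_on_to_nat_on)
  also have "(UNIV :: nat set set) \<approx> (UNIV :: real set)" by (rule nat_sets_eqpoll_reals)
  finally show ?thesis .
qed

section \<open>Partition regular functions and their tail filters\<close>

definition tail_filter :: "'o set \<Rightarrow> ('o set \<Rightarrow> 'l set) \<Rightarrow> 'o set \<Rightarrow> 'l filter" where
  "tail_filter \<Omega> \<rho> F = (INF K\<in>{K. finite K \<and> K \<subseteq> \<Omega>}. principal (\<rho> (F - K)))"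

lemma le_tail_filter_iff:
  "G \<le> tail_filter \<Omega> \<rho> F \<longleftrightarrow>
     (\<forall>K. finite K \<and> K \<subseteq> \<Omega> \<longrightarrow> (\<forall>\<^sub>F a in G. a \<in> \<rho> (F - K)))"
  by (auto simp: tail_filter_def le_INF_iff le_principal)

locale partition_regular_function =
  fixes \<Lambda> :: "'l set" and \<Omega> :: "'o set" and \<F> :: "'o set set" and \<rho> :: "'o set \<Rightarrow> 'l set"
  assumes partition_regular: "partition_regular \<Lambda> \<Omega> \<F> \<rho>"
begin

lemma countable_infinite_base_sets:
  shows countable_\<Lambda>: "countable \<Lambda>" and infinite_\<Lambda>: "infinite \<Lambda>" and countable_\<Omega>: "countable \<Omega>"
  using partition_regular unfolding partition_regular_def by simp_all

lemma diff_finite: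
  assumes "F \<in> \<F>" "finite K" "K \<subseteq> \<Omega>"
  shows "F - K \<in> \<F>"
proof -
  have "\<forall>F\<in>\<F>. \<forall>K. K \<subseteq> \<Omega> \<and> finite K \<longrightarrow> F - K \<in> \<F>"
    using partition_regular unfolding partition_regular_def by (elim conjE)
  with assms show ?thesis by blast
qed

lemma \<rho>_mono:
  assumes "E \<in> \<F>" "F \<in> \<F>" "E \<subseteq> F"
  shows "\<rho> E \<subseteq> \<rho> F"
proof -
  have "\<forall>E\<in>\<F>. \<forall>F\<in>\<F>. E \<subseteq> F \<longrightarrow> \<rho> E \<subseteq> \<rho> F"
    using partition_regular unfolding partition_regular_def by (elim conjE)
  with assms show ?thesis by blast
qed

lemma \<rho>_infinite_subset:
  assumes "F \<in> \<F>"
  shows \<rho>_subset: "\<rho> F \<subseteq> \<Lambda>" and infinite_\<rho>: "infinite (\<rho> F)"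
proof -
  have "\<forall>F\<in>\<F>. \<rho> F \<subseteq> \<Lambda> \<and> infinite (\<rho> F)"
    using partition_regular unfolding partition_regular_def by (elim conjE)
  with assms show "\<rho> F \<subseteq> \<Lambda>" "infinite (\<rho> F)" by blast+
qed

abbreviation tails :: "'o set \<Rightarrow> 'l filter" where
  "tails \<equiv> tail_filter \<Omega> \<rho>"

lemma eventually_tails_iff:
  assumes "F \<in> \<F>"
  shows "eventually P (tails F) \<longleftrightarrow> (\<exists>K. finite K \<and> K \<subseteq> \<Omega> \<and> (\<forall>a\<in>\<rho> (F - K). P a))"
proof -
  have "\<exists>M\<in>{K. finite K \<and> K \<subseteq> \<Omega>}.
      principal (\<rho> (F - M)) \<le> inf (principal (\<rho> (F - K))) (principal (\<rho> (F - L)))"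
    if "K \<in> {K. finite K \<and> K \<subseteq> \<Omega>}" "L \<in> {K. finite K \<and> K \<subseteq> \<Omega>}" for K L
  proof
    show "K \<union> L \<in> {K. finite K \<and> K \<subseteq> \<Omega>}" using that by simp
    have "\<rho> (F - (K \<union> L)) \<subseteq> \<rho> (F - K)" "\<rho> (F - (K \<union> L)) \<subseteq> \<rho> (F - L)"
      using that assms by (intro \<rho>_mono diff_finite; auto)+
    then show "principal (\<rho> (F - (K \<union> L))) \<le> inf (principal (\<rho> (F - K))) (principal (\<rho> (F - L)))"
      by simp
  qed
  then show ?thesis
    unfolding tail_filter_def
    by (subst eventually_INF_base) (auto simp: eventually_principal)
qed

lemma eventually_in_\<rho>_diff:
  assumes "finite K" "K \<subseteq> \<Omega>"
  shows "\<forall>\<^sub>F a in tails F. a \<in> \<rho> (F - K)"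
  using le_tail_filter_iff[of "tails F" \<Omega> \<rho> F] assms by blast

lemma eventually_in_\<rho>: "\<forall>\<^sub>F a in tails F. a \<in> \<rho> F"
  using eventually_in_\<rho>_diff[of "{}"] by simp

lemma eventually_in_\<Lambda>: "F \<in> \<F> \<Longrightarrow> \<forall>\<^sub>F a in tails F. a \<in> \<Lambda>"
  using eventually_in_\<rho>[of F] by (rule eventually_mono) (use \<rho>_subset in blast)

lemma tails_mono:
  assumes "E \<in> \<F>" "F \<in> \<F>" "E \<subseteq> F"
  shows "tails E \<le> tails F"
  unfolding le_tail_filter_iff
proof (intro allI impI)
  fix K assume K: "finite K \<and> K \<subseteq> \<Omega>"
  have "\<rho> (E - K) \<subseteq> \<rho> (F - K)"
    using assms K by (intro \<rho>_mono diff_finite) auto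
  then show "\<forall>\<^sub>F a in tails E. a \<in> \<rho> (F - K)"
    using eventually_in_\<rho>_diff[of K E] K by (auto elim: eventually_mono)
qed

lemma countably_generated_tails:
  assumes "F \<in> \<F>"
  shows "countably_generated (tails F)"
proof (rule countably_generatedI)
  show "countable ((\<lambda>K. \<rho> (F - K)) ` {K. finite K \<and> K \<subseteq> \<Omega>})"
    using countable_\<Omega> by (intro countable_image countable_Collect_finite_subset)
  show "eventually P (tails F) \<longleftrightarrow>
      (\<exists>B\<in>(\<lambda>K. \<rho> (F - K)) ` {K. finite K \<and> K \<subseteq> \<Omega>}. \<forall>a\<in>B. P a)" for P
    by (simp add: eventually_tails_iff[OF assms])
qed

lemma all_members_infinite_tails:
  assumes "F \<in> \<F>"
  shows "all_members_infinite (tails F)"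
  unfolding all_members_infinite_def eventually_tails_iff[OF assms]
proof (intro allI impI, elim exE conjE)
  fix A K assume K: "finite K" "K \<subseteq> \<Omega>" "\<forall>a\<in>\<rho> (F - K). a \<in> A"
  have "infinite (\<rho> (F - K))" using infinite_\<rho> diff_finite assms K by blast
  then show "infinite A" using K(3) finite_subset[of "\<rho> (F - K)" A] by blast
qed

lemma countably_generated_filtermap_tails:
  "F \<in> \<F> \<Longrightarrow> countably_generated (filtermap h (tails F))"
  by (intro countably_generated_filtermap countably_generated_tails)

lemma all_members_infinite_filtermap_tails:
  "F \<in> \<F> \<Longrightarrow> inj_on h \<Lambda> \<Longrightarrow> all_members_infinite (filtermap h (tails F))"
  by (rule all_members_infinite_filtermap[OF all_members_infinite_tails eventually_in_\<Lambda>])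

lemma filtermap_tails_le_principal:
  assumes "F \<in> \<F>" "h \<in> \<Lambda> \<rightarrow> N"
  shows "filtermap h (tails F) \<le> principal N"
  unfolding le_principal eventually_filtermap
  using eventually_in_\<Lambda>[OF assms(1)] by (rule eventually_mono) (use assms(2) in blast)

lemma exists_member_\<rho>_subset:
  assumes "F \<in> \<F>" "\<forall>\<^sub>F a in tails F. a \<in> A"
  obtains G where "G \<in> \<F>" "G \<subseteq> F" "\<rho> G \<subseteq> A"
proof -
  obtain K where "finite K" "K \<subseteq> \<Omega>" "\<rho> (F - K) \<subseteq> A"
    using assms(2) unfolding eventually_tails_iff[OF assms(1)] by blast
  then show thesis using assms(1) diff_finite by (intro that[of "F - K"]) auto
qed

lemma almost_subset_iff_eventually:
  "F \<in> \<F> \<Longrightarrow> almost_subset \<Omega> \<rho> F B \<longleftrightarrow> (\<forall>\<^sub>F a in tails F. a \<in> B)"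
  unfolding almost_subset_def by (auto simp: eventually_tails_iff)

lemma rho_convergent_iff_limitin:
  assumes "F \<in> \<F>"
  shows "rho_convergent \<Omega> \<rho> F X f x \<longleftrightarrow> limitin X f x (tails F)"
proof -
  have "(\<exists>K. K \<subseteq> \<Omega> \<and> finite K \<and> f ` \<rho> (F - K) \<subseteq> U) \<longleftrightarrow> (\<forall>\<^sub>F a in tails F. f a \<in> U)" for U
    unfolding eventually_tails_iff[OF assms] image_subset_iff by blast
  then show ?thesis
    unfolding rho_convergent_def limitin_def by simp
qed

lemma FinBW_iff_limitin:
  "X \<in> FinBW \<Lambda> \<Omega> \<F> \<rho> \<longleftrightarrow>
     (\<forall>f \<in> \<Lambda> \<rightarrow> topspace X. \<exists>F\<in>\<F>. \<exists>x. limitin X f x (tails F))"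
proof -
  have "(\<exists>x. rho_convergent \<Omega> \<rho> F X f x) \<longleftrightarrow> (\<exists>x. limitin X f x (tails F))"
    if "F \<in> \<F>" for F f
    by (simp only: rho_convergent_iff_limitin[OF that])
  then show ?thesis
    unfolding FinBW_def by (simp cong: bex_cong)
qed

end

locale partition_regular_pair =
  \<rho>\<^sub>1: partition_regular_function \<Lambda>\<^sub>1 \<Omega>\<^sub>1 \<F>\<^sub>1 \<rho>\<^sub>1 + \<rho>\<^sub>2: partition_regular_function \<Lambda>\<^sub>2 \<Omega>\<^sub>2 \<F>\<^sub>2 \<rho>\<^sub>2
  for \<Lambda>\<^sub>1 :: "'l1 set" and \<Omega>\<^sub>1 :: "'o1 set" and \<F>\<^sub>1 and \<rho>\<^sub>1
    and \<Lambda>\<^sub>2 :: "'l2 set" and \<Omega>\<^sub>2 :: "'o2 set" and \<F>\<^sub>2 and \<rho>\<^sub>2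
begin

lemma katetov_le_iff_tails_le:
  "katetov_le \<Lambda>\<^sub>2 \<Omega>\<^sub>2 \<F>\<^sub>2 \<rho>\<^sub>2 \<Lambda>\<^sub>1 \<Omega>\<^sub>1 \<F>\<^sub>1 \<rho>\<^sub>1 \<longleftrightarrow>
     (\<exists>\<phi> \<in> \<Lambda>\<^sub>1 \<rightarrow> \<Lambda>\<^sub>2. \<forall>F\<^sub>1\<in>\<F>\<^sub>1. \<exists>F\<^sub>2\<in>\<F>\<^sub>2. \<rho>\<^sub>2.tails F\<^sub>2 \<le> filtermap \<phi> (\<rho>\<^sub>1.tails F\<^sub>1))"
proof -
  have "\<rho>\<^sub>2.tails F\<^sub>2 \<le> filtermap \<phi> (\<rho>\<^sub>1.tails F\<^sub>1) \<longleftrightarrow>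
      (\<forall>K\<^sub>1. K\<^sub>1 \<subseteq> \<Omega>\<^sub>1 \<and> finite K\<^sub>1 \<longrightarrow>
        (\<exists>K\<^sub>2. K\<^sub>2 \<subseteq> \<Omega>\<^sub>2 \<and> finite K\<^sub>2 \<and> \<rho>\<^sub>2 (F\<^sub>2 - K\<^sub>2) \<subseteq> \<phi> ` \<rho>\<^sub>1 (F\<^sub>1 - K\<^sub>1)))"
    (is "?le \<longleftrightarrow> ?base") if F: "F\<^sub>1 \<in> \<F>\<^sub>1" "F\<^sub>2 \<in> \<F>\<^sub>2" for F\<^sub>1 F\<^sub>2 \<phi>
  proof
    assume ?le
    show ?base
    proof (intro allI impI)
      fix K\<^sub>1 assume "K\<^sub>1 \<subseteq> \<Omega>\<^sub>1 \<and> finite K\<^sub>1"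
      then have "\<forall>\<^sub>F a in \<rho>\<^sub>1.tails F\<^sub>1. \<phi> a \<in> \<phi> ` \<rho>\<^sub>1 (F\<^sub>1 - K\<^sub>1)"
        using \<rho>\<^sub>1.eventually_in_\<rho>_diff[of K\<^sub>1 F\<^sub>1] by (auto elim: eventually_mono)
      then have "\<forall>\<^sub>F b in \<rho>\<^sub>2.tails F\<^sub>2. b \<in> \<phi> ` \<rho>\<^sub>1 (F\<^sub>1 - K\<^sub>1)"
        using \<open>?le\<close> by (simp add: filter_leD eventually_filtermap)
      then show "\<exists>K\<^sub>2. K\<^sub>2 \<subseteq> \<Omega>\<^sub>2 \<and> finite K\<^sub>2 \<and> \<rho>\<^sub>2 (F\<^sub>2 - K\<^sub>2) \<subseteq> \<phi> ` \<rho>\<^sub>1 (F\<^sub>1 - K\<^sub>1)"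
        unfolding \<rho>\<^sub>2.eventually_tails_iff[OF F(2)] by blast
    qed
  next
    assume ?base
    then show ?le
      unfolding le_filter_def eventually_filtermap \<rho>\<^sub>1.eventually_tails_iff[OF F(1)]
        \<rho>\<^sub>2.eventually_tails_iff[OF F(2)]
      by (metis (lifting) imageE subsetD)
  qed
  then show ?thesis
    unfolding katetov_le_def by (simp cong: ball_cong bex_cong)
qed

lemma FinBW_subset_if_katetov_le:
  assumes "katetov_le \<Lambda>\<^sub>2 \<Omega>\<^sub>2 \<F>\<^sub>2 \<rho>\<^sub>2 \<Lambda>\<^sub>1 \<Omega>\<^sub>1 \<F>\<^sub>1 \<rho>\<^sub>1"
  shows "(FinBW \<Lambda>\<^sub>1 \<Omega>\<^sub>1 \<F>\<^sub>1 \<rho>\<^sub>1 :: 'x topology set) \<subseteq> FinBW \<Lambda>\<^sub>2 \<Omega>\<^sub>2 \<F>\<^sub>2 \<rho>\<^sub>2"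
proof
  obtain \<phi> where \<phi>: "\<phi> \<in> \<Lambda>\<^sub>1 \<rightarrow> \<Lambda>\<^sub>2"
    "\<And>F\<^sub>1. F\<^sub>1 \<in> \<F>\<^sub>1 \<Longrightarrow> \<exists>F\<^sub>2\<in>\<F>\<^sub>2. \<rho>\<^sub>2.tails F\<^sub>2 \<le> filtermap \<phi> (\<rho>\<^sub>1.tails F\<^sub>1)"
    using assms unfolding katetov_le_iff_tails_le by blast
  fix X :: "'x topology" assume X: "X \<in> FinBW \<Lambda>\<^sub>1 \<Omega>\<^sub>1 \<F>\<^sub>1 \<rho>\<^sub>1"
  show "X \<in> FinBW \<Lambda>\<^sub>2 \<Omega>\<^sub>2 \<F>\<^sub>2 \<rho>\<^sub>2"
    unfolding \<rho>\<^sub>2.FinBW_iff_limitin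
  proof
    fix f assume "f \<in> \<Lambda>\<^sub>2 \<rightarrow> topspace X"
    then have "(\<lambda>a. f (\<phi> a)) \<in> \<Lambda>\<^sub>1 \<rightarrow> topspace X" using \<phi>(1) by auto
    then obtain F\<^sub>1 x where F\<^sub>1: "F\<^sub>1 \<in> \<F>\<^sub>1" "limitin X (\<lambda>a. f (\<phi> a)) x (\<rho>\<^sub>1.tails F\<^sub>1)"
      using X unfolding \<rho>\<^sub>1.FinBW_iff_limitin by meson
    obtain F\<^sub>2 where F\<^sub>2: "F\<^sub>2 \<in> \<F>\<^sub>2" "\<rho>\<^sub>2.tails F\<^sub>2 \<le> filtermap \<phi> (\<rho>\<^sub>1.tails F\<^sub>1)"
      using \<phi>(2) F\<^sub>1(1) by blast
    have "limitin X f x (\<rho>\<^sub>2.tails F\<^sub>2)"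
      using F\<^sub>1(2) by (intro limitin_mono[OF _ F\<^sub>2(2)]) (simp add: limitin_filtermap)
    with F\<^sub>2(1) show "\<exists>F\<in>\<F>\<^sub>2. \<exists>x. limitin X f x (\<rho>\<^sub>2.tails F)" by blast
  qed
qed

lemma filtermap_tails_not_le_if_not_katetov_le:
  assumes "\<not> katetov_le \<Lambda>\<^sub>2 \<Omega>\<^sub>2 \<F>\<^sub>2 \<rho>\<^sub>2 \<Lambda>\<^sub>1 \<Omega>\<^sub>1 \<F>\<^sub>1 \<rho>\<^sub>1" "inj_on e \<Lambda>\<^sub>2" "h \<in> \<Lambda>\<^sub>1 \<rightarrow> e ` \<Lambda>\<^sub>2"
  shows "\<exists>F\<^sub>1\<in>\<F>\<^sub>1. \<forall>F\<^sub>2\<in>\<F>\<^sub>2. \<not> filtermap e (\<rho>\<^sub>2.tails F\<^sub>2) \<le> filtermap h (\<rho>\<^sub>1.tails F\<^sub>1)"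
proof -
  let ?\<phi> = "inv_into \<Lambda>\<^sub>2 e \<circ> h"
  have "?\<phi> \<in> \<Lambda>\<^sub>1 \<rightarrow> \<Lambda>\<^sub>2"
    using assms(3) by (simp add: Pi_iff inv_into_into)
  then obtain F\<^sub>1 where F\<^sub>1: "F\<^sub>1 \<in> \<F>\<^sub>1"
    "\<And>F\<^sub>2. F\<^sub>2 \<in> \<F>\<^sub>2 \<Longrightarrow> \<not> \<rho>\<^sub>2.tails F\<^sub>2 \<le> filtermap ?\<phi> (\<rho>\<^sub>1.tails F\<^sub>1)"
    using assms(1) unfolding katetov_le_iff_tails_le by blast
  have "\<rho>\<^sub>2.tails F\<^sub>2 \<le> filtermap ?\<phi> (\<rho>\<^sub>1.tails F\<^sub>1)"
    if F\<^sub>2: "F\<^sub>2 \<in> \<F>\<^sub>2" "filtermap e (\<rho>\<^sub>2.tails F\<^sub>2) \<le> filtermap h (\<rho>\<^sub>1.tails F\<^sub>1)" for F\<^sub>2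
  proof -
    have "\<forall>\<^sub>F b in \<rho>\<^sub>2.tails F\<^sub>2. inv_into \<Lambda>\<^sub>2 e (e b) = b"
      using \<rho>\<^sub>2.eventually_in_\<Lambda>[OF F\<^sub>2(1)] by (rule eventually_mono) (simp add: assms(2))
    then have "\<rho>\<^sub>2.tails F\<^sub>2 = filtermap (inv_into \<Lambda>\<^sub>2 e) (filtermap e (\<rho>\<^sub>2.tails F\<^sub>2))"
      using filtermap_cong[of "\<lambda>b. inv_into \<Lambda>\<^sub>2 e (e b)" "\<lambda>b. b"] by (simp add: filtermap_filtermap)
    also have "\<dots> \<le> filtermap ?\<phi> (\<rho>\<^sub>1.tails F\<^sub>1)"
      using filtermap_mono[OF F\<^sub>2(2)] by (simp add: filtermap_filtermap comp_def)
    finally show ?thesis .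
  qed
  with F\<^sub>1 show ?thesis by blast
qed

end

section \<open>Diagonalisation\<close>

context partition_regular_function
begin

definition ideal_positive :: "'l set \<Rightarrow> bool" where
  "ideal_positive A \<longleftrightarrow> (\<exists>F\<in>\<F>. \<rho> F \<subseteq> A)"

lemma ideal_positive_\<rho>: "F \<in> \<F> \<Longrightarrow> ideal_positive (\<rho> F)"
  unfolding ideal_positive_def by blast

lemma ideal_positive_mono: "ideal_positive A \<Longrightarrow> A \<subseteq> B \<Longrightarrow> ideal_positive B"
  unfolding ideal_positive_def by blast

lemma ideal_positive_Un_cases:
  assumes "ideal_positive (A \<union> B)"
  shows "ideal_positive A \<or> ideal_positive B"
proof -
  have regular: "\<forall>F\<in>\<F>. \<forall>A B. A \<subseteq> \<Lambda> \<and> B \<subseteq> \<Lambda> \<and> \<rho> F = A \<union> B \<longrightarrow>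
      (\<exists>E\<in>\<F>. \<rho> E \<subseteq> A \<or> \<rho> E \<subseteq> B)"
    using partition_regular unfolding partition_regular_def by (elim conjE)
  obtain F where F: "F \<in> \<F>" "\<rho> F \<subseteq> A \<union> B" using assms unfolding ideal_positive_def by blast
  then have "\<rho> F \<inter> A \<subseteq> \<Lambda> \<and> \<rho> F \<inter> B \<subseteq> \<Lambda> \<and> \<rho> F = \<rho> F \<inter> A \<union> \<rho> F \<inter> B"
    using \<rho>_subset[OF F(1)] by blast
  with regular F(1) have "\<exists>E\<in>\<F>. \<rho> E \<subseteq> \<rho> F \<inter> A \<or> \<rho> E \<subseteq> \<rho> F \<inter> B" by meson
  then show ?thesis unfolding ideal_positive_def by blast
qed

definition dense_below :: "'o set \<Rightarrow> 'l set set \<Rightarrow> bool" where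
  "dense_below F \<D> \<longleftrightarrow> (\<forall>E\<in>\<F>. \<rho> E \<subseteq> \<rho> F \<longrightarrow> (\<exists>A\<in>\<D>. ideal_positive (\<rho> E \<inter> A)))"

lemma dense_below_mono: "dense_below F \<D> \<Longrightarrow> \<rho> E \<subseteq> \<rho> F \<Longrightarrow> dense_below E \<D>"
  unfolding dense_below_def by blast

lemma dense_below_singleton:
  assumes "\<not> ideal_positive (\<rho> F - A)"
  shows "dense_below F {A}"
  unfolding dense_below_def
proof (intro ballI impI)
  fix E assume E: "E \<in> \<F>" "\<rho> E \<subseteq> \<rho> F"
  have "ideal_positive (\<rho> E \<inter> A \<union> (\<rho> E - A))" using ideal_positive_\<rho>[OF E(1)] by (simp add: Int_Diff_Un)
  moreover have "\<not> ideal_positive (\<rho> E - A)" using assms E(2) ideal_positive_mono by (meson Diff_mono order_refl)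
  ultimately show "\<exists>A\<in>{A}. ideal_positive (\<rho> E \<inter> A)" using ideal_positive_Un_cases by blast
qed

definition P_plus_at :: "'o set \<Rightarrow> bool" where
  "P_plus_at F \<longleftrightarrow> (\<forall>S. (\<forall>n::nat. S n \<in> \<F> \<and> \<rho> (S n) \<subseteq> \<rho> F \<and> \<rho> (S (Suc n)) \<subseteq> \<rho> (S n)) \<longrightarrow>
     (\<exists>G\<in>\<F>. \<forall>n. \<forall>\<^sub>F a in tails G. a \<in> \<rho> (S n)))"

lemma P_plus_at_mono: "P_plus_at F \<Longrightarrow> \<rho> E \<subseteq> \<rho> F \<Longrightarrow> P_plus_at E"
  unfolding P_plus_at_def by (meson subset_trans)

lemma diagonalization:
  assumes F: "F \<in> \<F>" "P_plus_at F" and I: "countable I" "\<forall>i\<in>I. dense_below F (\<D> i)"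
  shows "\<exists>G\<in>\<F>. \<rho> G \<subseteq> \<rho> F \<and> (\<forall>i\<in>I. \<exists>A\<in>\<D> i. \<forall>\<^sub>F a in tails G. a \<in> A)"
proof (cases "I = {}")
  case True
  then show ?thesis using F(1) by blast
next
  case False
  define e where "e = from_nat_into I"
  have "\<exists>S. \<forall>n. (S n \<in> \<F> \<and> \<rho> (S n) \<subseteq> \<rho> F) \<and>
      (\<rho> (S (Suc n)) \<subseteq> \<rho> (S n) \<and> (\<exists>A\<in>\<D> (e n). \<rho> (S (Suc n)) \<subseteq> A))"
  proof (rule dependent_nat_choice)
    show "\<exists>E. E \<in> \<F> \<and> \<rho> E \<subseteq> \<rho> F" using F(1) by blast
  next
    fix E n assume E: "E \<in> \<F> \<and> \<rho> E \<subseteq> \<rho> F"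
    have "dense_below F (\<D> (e n))" using I(2) from_nat_into[OF False] unfolding e_def by blast
    with E obtain A where "A \<in> \<D> (e n)" "ideal_positive (\<rho> E \<inter> A)" unfolding dense_below_def by blast
    with E show "\<exists>E'. (E' \<in> \<F> \<and> \<rho> E' \<subseteq> \<rho> F) \<and> (\<rho> E' \<subseteq> \<rho> E \<and> (\<exists>A\<in>\<D> (e n). \<rho> E' \<subseteq> A))"
      unfolding ideal_positive_def by blast
  qed
  then obtain S where S: "\<And>n. S n \<in> \<F> \<and> \<rho> (S n) \<subseteq> \<rho> F \<and> \<rho> (S (Suc n)) \<subseteq> \<rho> (S n)"
    "\<And>n. \<exists>A\<in>\<D> (e n). \<rho> (S (Suc n)) \<subseteq> A"
    by metis
  then obtain G' where G': "G' \<in> \<F>" "\<And>n. \<forall>\<^sub>F a in tails G'. a \<in> \<rho> (S n)"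
    using F(2) unfolding P_plus_at_def by meson
  obtain G where G: "G \<in> \<F>" "G \<subseteq> G'" "\<rho> G \<subseteq> \<rho> (S 0)"
    using exists_member_\<rho>_subset[OF G'(1) G'(2)] by blast
  have "\<exists>A\<in>\<D> i. \<forall>\<^sub>F a in tails G. a \<in> A" if "i \<in> I" for i
  proof -
    obtain n where "i = e n"
      using from_nat_into_surj[OF I(1) \<open>i \<in> I\<close>] unfolding e_def by blast
    with S(2) obtain A where A: "A \<in> \<D> i" "\<rho> (S (Suc n)) \<subseteq> A" by blast
    have "\<forall>\<^sub>F a in tails G. a \<in> \<rho> (S (Suc n))"
      using tails_mono[OF G(1) G'(1) G(2)] G'(2) by (rule filter_leD)
    then have "\<forall>\<^sub>F a in tails G. a \<in> A" using A(2) by (auto elim: eventually_mono)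
    with A(1) show ?thesis by blast
  qed
  with G(1,3) S(1)[of 0] show ?thesis by blast
qed

lemma dense_below_filter_complements:
  assumes E: "E \<in> \<F>" "P_plus_at E" and D: "countably_generated D"
    and no_limit: "\<And>F. F \<in> \<F> \<Longrightarrow> \<not> filtermap h (tails F) \<le> D"
  shows "dense_below E {h -` (- A) | A. \<forall>\<^sub>F x in D. x \<in> A}"
  unfolding dense_below_def
proof (intro ballI impI, rule ccontr)
  fix F assume F: "F \<in> \<F>" "\<rho> F \<subseteq> \<rho> E"
    and none_positive: "\<not> (\<exists>B\<in>{h -` (- A) | A. \<forall>\<^sub>F x in D. x \<in> A}. ideal_positive (\<rho> F \<inter> B))"
  obtain \<B> where \<B>: "countable \<B>" "\<And>P. eventually P D \<longleftrightarrow> (\<exists>B\<in>\<B>. \<forall>x\<in>B. P x)"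
    using D unfolding countably_generated_def by blast
  have "\<forall>B\<in>\<B>. dense_below F {h -` B}"
  proof (intro ballI dense_below_singleton)
    fix B assume "B \<in> \<B>"
    then have "\<forall>\<^sub>F x in D. x \<in> B" unfolding \<B>(2) by blast
    with none_positive have "\<not> ideal_positive (\<rho> F \<inter> h -` (- B))" by blast
    then show "\<not> ideal_positive (\<rho> F - h -` B)" by (simp add: vimage_Compl Diff_eq)
  qed
  then obtain G where G: "G \<in> \<F>" "\<forall>B\<in>\<B>. \<exists>A\<in>{h -` B}. \<forall>\<^sub>F a in tails G. a \<in> A"
    using diagonalization[OF F(1) P_plus_at_mono[OF E(2) F(2)] \<B>(1), of "\<lambda>B. {h -` B}"] by blast
  have "eventually P (filtermap h (tails G))" if P: "eventually P D" for P
  proof -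
    obtain B where B: "B \<in> \<B>" "\<forall>x\<in>B. P x" using P unfolding \<B>(2) by blast
    have "\<forall>\<^sub>F a in tails G. a \<in> h -` B" using G(2) B(1) by simp
    with B(2) show ?thesis unfolding eventually_filtermap by (auto elim: eventually_mono)
  qed
  then have "filtermap h (tails G) \<le> D" by (rule filter_leI)
  with no_limit G(1) show False by blast
qed

definition nowhere_constant :: "('l \<Rightarrow> 'x) \<Rightarrow> bool" where
  "nowhere_constant h \<longleftrightarrow> (\<forall>F\<in>\<F>. \<forall>x. \<not> h ` \<rho> F \<subseteq> {x})"

definition convergent_to :: "('l \<Rightarrow> 'x) \<Rightarrow> 'x filter \<Rightarrow> bool" where
  "convergent_to h D \<longleftrightarrow> (\<exists>F\<in>\<F>. filtermap h (tails F) \<le> D)"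

lemma nowhere_constant_restrict: "nowhere_constant (restrict h \<Lambda>) \<longleftrightarrow> nowhere_constant h"
proof -
  have "restrict h \<Lambda> ` \<rho> F = h ` \<rho> F" if "F \<in> \<F>" for F
    using \<rho>_subset[OF that] by (intro image_cong) auto
  then show ?thesis unfolding nowhere_constant_def by simp
qed

lemma convergent_to_restrict: "convergent_to (restrict h \<Lambda>) D \<longleftrightarrow> convergent_to h D"
proof -
  have "filtermap (restrict h \<Lambda>) (tails F) = filtermap h (tails F)" if "F \<in> \<F>" for F
    using eventually_in_\<Lambda>[OF that] by (intro filtermap_cong) (auto elim: eventually_mono)
  then show ?thesis unfolding convergent_to_def by simp
qed

lemma nowhere_constant_not_convergent_to_point:
  assumes "nowhere_constant h"
  shows "\<not> convergent_to h (principal {x})"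
proof
  assume "convergent_to h (principal {x})"
  then obtain F where F: "F \<in> \<F>" "\<forall>\<^sub>F a in tails F. a \<in> h -` {x}"
    unfolding convergent_to_def le_principal eventually_filtermap by auto
  then obtain G where "G \<in> \<F>" "\<rho> G \<subseteq> h -` {x}" by (rule exists_member_\<rho>_subset)
  then show False using assms unfolding nowhere_constant_def by blast
qed

end

locale weak_P_plus_function = partition_regular_function \<Lambda> \<Omega> \<F> \<rho>
  for \<Lambda> :: "'l set" and \<Omega> :: "'o set" and \<F> and \<rho> +
  assumes weak_P_plus: "weak_P_plus \<Omega> \<F> \<rho>"
begin

lemma P_plus_at_exists:
  assumes "E \<in> \<F>"
  obtains F where "F \<in> \<F>" "\<rho> F \<subseteq> \<rho> E" "P_plus_at F"
proof -
  obtain F where F: "F \<in> \<F>" "\<rho> F \<subseteq> \<rho> E"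
    "\<forall>S :: nat \<Rightarrow> _. (\<forall>n. S n \<in> \<F> \<and> \<rho> (S n) \<subseteq> \<rho> F \<and> \<rho> (S (Suc n)) \<subseteq> \<rho> (S n)) \<longrightarrow>
      (\<exists>G\<in>\<F>. \<forall>n. almost_subset \<Omega> \<rho> G (\<rho> (S n)))"
    using bspec[OF weak_P_plus[unfolded weak_P_plus_def] assms] by (elim bexE conjE)
  then have "P_plus_at F"
    unfolding P_plus_at_def by (simp add: almost_subset_iff_eventually cong: bex_cong)
  with F(1,2) show thesis by (rule that)
qed

lemma constant_or_finite_to_one:
  assumes "ideal_positive A"
  shows "\<exists>F\<in>\<F>. \<rho> F \<subseteq> A \<and> ((\<exists>x. f ` \<rho> F \<subseteq> {x}) \<or> filterlim f cofinite (tails F))"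
proof (rule ccontr)
  assume neither: "\<not> ?thesis"
  obtain E where E: "E \<in> \<F>" "\<rho> E \<subseteq> A" using assms unfolding ideal_positive_def by blast
  obtain F where F: "F \<in> \<F>" "\<rho> F \<subseteq> \<rho> E" "P_plus_at F"
    using P_plus_at_exists[OF E(1)] .
  have "\<forall>x\<in>f ` \<Lambda>. dense_below F {f -` (- {x})}"
  proof (intro ballI dense_below_singleton notI)
    fix x assume "ideal_positive (\<rho> F - f -` (- {x}))"
    then obtain G where G: "G \<in> \<F>" "\<rho> G \<subseteq> \<rho> F - f -` (- {x})"
      unfolding ideal_positive_def by blast
    then have "\<rho> G \<subseteq> A" "f ` \<rho> G \<subseteq> {x}" using E(2) F(2) by auto
    with neither G(1) show False by meson
  qed
  then obtain G where G: "G \<in> \<F>" "\<rho> G \<subseteq> \<rho> F"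
    "\<forall>x\<in>f ` \<Lambda>. \<exists>A\<in>{f -` (- {x})}. \<forall>\<^sub>F a in tails G. a \<in> A"
    using diagonalization[OF F(1,3), of "f ` \<Lambda>" "\<lambda>x. {f -` (- {x})}"] countable_\<Lambda> by blast
  have "\<forall>\<^sub>F a in tails G. f a \<noteq> x" for x
  proof (cases "x \<in> f ` \<Lambda>")
    case True
    then show ?thesis using G(3) by auto
  next
    case False
    then show ?thesis using eventually_in_\<Lambda>[OF G(1)] by (auto elim: eventually_mono)
  qed
  then have "filterlim f cofinite (tails G)" by (rule filterlim_cofiniteI)
  moreover have "\<rho> G \<subseteq> A" using G(2) F(2) E(2) by blast
  ultimately show False using neither G(1) by meson
qed

end

locale weak_P_plus_small_accretions = weak_P_plus_function \<Lambda> \<Omega> \<F> \<rho>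
  for \<Lambda> :: "'l set" and \<Omega> :: "'o set" and \<F> and \<rho> +
  assumes small_accretions: "has_small_accretions \<Lambda> \<Omega> \<F> \<rho>"
begin

lemma tail_diagonalization:
  assumes E: "E \<in> \<F>" and I: "countable I"
    "\<forall>F\<in>\<F>. P_plus_at F \<longrightarrow> (\<forall>i\<in>I. dense_below F (\<D> i))"
  shows "\<exists>G\<in>\<F>. tails G \<le> tails E \<and> (\<forall>i\<in>I. \<exists>A\<in>\<D> i. \<forall>\<^sub>F a in tails G. a \<in> A)"
proof -
  obtain E' where E': "E' \<in> \<F>" "E' \<subseteq> E" "set_has_small_accretions \<Lambda> \<Omega> \<F> \<rho> E'"
    using small_accretions E unfolding has_small_accretions_def by blast
  obtain F where F: "F \<in> \<F>" "\<rho> F \<subseteq> \<rho> E'" "P_plus_at F"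
    using P_plus_at_exists[OF E'(1)] .
  let ?J = "{K. finite K \<and> K \<subseteq> \<Omega>} <+> I" and ?\<D>' = "case_sum (\<lambda>K. {\<rho> (E' - K)}) \<D>"
  have "dense_below E' {\<rho> (E' - K)}" if "finite K" "K \<subseteq> \<Omega>" for K
    using E'(3) that unfolding set_has_small_accretions_def ideal_of_def
    by (intro dense_below_singleton) (auto simp: ideal_positive_def)
  then have "\<forall>j\<in>?J. dense_below F (?\<D>' j)"
    using dense_below_mono[OF _ F(2)] F(1,3) I(2) by auto
  moreover have "countable ?J"
    using countable_\<Omega> I(1) by (intro countable_Plus countable_Collect_finite_subset)
  ultimately obtain G where G: "G \<in> \<F>" "\<forall>j\<in>?J. \<exists>A\<in>?\<D>' j. \<forall>\<^sub>F a in tails G. a \<in> A"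
    using diagonalization[OF F(1,3), of ?J ?\<D>'] by blast
  have "tails G \<le> tails E'"
    unfolding le_tail_filter_iff using bspec[OF G(2) InlI] by simp
  also have "\<dots> \<le> tails E" using tails_mono E'(1,2) E by blast
  finally show ?thesis using G(1) bspec[OF G(2) InrI] by auto
qed

lemma tail_refinement_into:
  assumes "E \<in> \<F>" "\<not> ideal_positive (\<Lambda> - A)"
  obtains F where "F \<in> \<F>" "tails F \<le> tails E" "\<forall>\<^sub>F a in tails F. a \<in> A"
proof -
  have "dense_below F {A}" if "F \<in> \<F>" for F
  proof (rule dense_below_singleton)
    have "\<rho> F - A \<subseteq> \<Lambda> - A" using \<rho>_subset[OF that] by blast
    then show "\<not> ideal_positive (\<rho> F - A)" using assms(2) ideal_positive_mono by blast
  qed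
  then show thesis
    using tail_diagonalization[OF assms(1), of "{()}" "\<lambda>_. {A}"] that by auto
qed

lemma tail_refinement_disjoint_from_filters:
  assumes E: "E \<in> \<F>" and \<Q>: "countable \<Q>" "\<forall>D\<in>\<Q>. countably_generated D"
    and no_limit: "\<forall>F\<in>\<F>. \<forall>D\<in>\<Q>. \<not> filtermap h (tails F) \<le> D"
  obtains F where "F \<in> \<F>" "tails F \<le> tails E"
    "\<forall>D\<in>\<Q>. inf (filtermap h (tails F)) D = bot"
proof -
  have "\<forall>F\<in>\<F>. P_plus_at F \<longrightarrow> (\<forall>D\<in>\<Q>. dense_below F {h -` (- A) | A. \<forall>\<^sub>F x in D. x \<in> A})"
    using \<Q>(2) no_limit by (intro ballI impI dense_below_filter_complements) blast+
  then obtain F where F: "F \<in> \<F>" "tails F \<le> tails E"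
    "\<forall>D\<in>\<Q>. \<exists>B\<in>{h -` (- A) | A. \<forall>\<^sub>F x in D. x \<in> A}. \<forall>\<^sub>F a in tails F. a \<in> B"
    using tail_diagonalization[OF E \<Q>(1), of "\<lambda>D. {h -` (- A) | A. \<forall>\<^sub>F x in D. x \<in> A}"] by blast
  have "inf (filtermap h (tails F)) D = bot" if "D \<in> \<Q>" for D
  proof -
    obtain A where "\<forall>\<^sub>F x in D. x \<in> A" "\<forall>\<^sub>F a in tails F. a \<in> h -` (- A)"
      using F(3) \<open>D \<in> \<Q>\<close> by blast
    then show ?thesis unfolding inf_eq_bot_iff by (auto simp: eventually_filtermap)
  qed
  then show thesis using that[OF F(1,2)] by blast
qed

end

section \<open>The space\<close>

text \<open>
  A variant of the Mrowka space: points of \<open>N\<close> are isolated, the trace on \<open>N\<close> of the neighbourhood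
  filter of \<open>i \<in> I\<close> is \<open>D i\<close>, and a neighbourhood of the extra point \<open>z\<close> contains all but finitely
  many points of \<open>I\<close>, with no further restriction on its trace on \<open>N\<close>.
\<close>

definition limit_points_topology ::
  "'x set \<Rightarrow> 'x set \<Rightarrow> 'x \<Rightarrow> ('x \<Rightarrow> 'x filter) \<Rightarrow> 'x topology" where
  "limit_points_topology N I z D = topology (\<lambda>U. U \<subseteq> insert z (N \<union> I) \<and>
     (\<forall>i\<in>U \<inter> I. \<forall>\<^sub>F x in D i. x \<in> U) \<and> (z \<in> U \<longrightarrow> finite (I - U)))"

locale limit_points_space =
  fixes N I :: "'x set" and z :: 'x and D :: "'x \<Rightarrow> 'x filter"
  assumes disjoint: "N \<inter> I = {}" "z \<notin> N" "z \<notin> I"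
    and countable_N: "countable N"
    and D_le_principal: "i \<in> I \<Longrightarrow> D i \<le> principal N"
    and D_le_cofinite: "i \<in> I \<Longrightarrow> D i \<le> cofinite"
    and D_neq_bot: "i \<in> I \<Longrightarrow> D i \<noteq> bot"
    and D_disjoint: "i \<in> I \<Longrightarrow> j \<in> I \<Longrightarrow> i \<noteq> j \<Longrightarrow> inf (D i) (D j) = bot"
begin

abbreviation X :: "'x topology" where
  "X \<equiv> limit_points_topology N I z D"

lemma openin_iff:
  "openin X U \<longleftrightarrow> U \<subseteq> insert z (N \<union> I) \<and>
     (\<forall>i\<in>U \<inter> I. \<forall>\<^sub>F x in D i. x \<in> U) \<and> (z \<in> U \<longrightarrow> finite (I - U))"
proof -
  have "istopology (\<lambda>U. U \<subseteq> insert z (N \<union> I) \<and>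
     (\<forall>i\<in>U \<inter> I. \<forall>\<^sub>F x in D i. x \<in> U) \<and> (z \<in> U \<longrightarrow> finite (I - U)))" (is "istopology ?P")
    unfolding istopology_def
  proof (rule conjI; intro allI impI)
    fix S U assume "?P S" "?P U"
    moreover have "I - S \<inter> U = (I - S) \<union> (I - U)" by blast
    ultimately show "?P (S \<inter> U)" by (auto intro: eventually_conj)
  next
    fix \<K> assume \<K>: "\<forall>K\<in>\<K>. ?P K"
    have "\<forall>\<^sub>F x in D i. x \<in> \<Union>\<K>" if "K \<in> \<K>" "i \<in> K \<inter> I" for i K
      using \<K> that by (blast intro: eventually_mono[of "\<lambda>x. x \<in> K"])
    moreover have "finite (I - \<Union>\<K>)" if "K \<in> \<K>" "z \<in> K" for K
      using \<K> that by (blast intro: finite_subset[of _ "I - K"])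
    moreover have "\<Union>\<K> \<subseteq> insert z (N \<union> I)" using \<K> by blast
    ultimately show "?P (\<Union>\<K>)" by blast
  qed
  then show ?thesis
    unfolding limit_points_topology_def by (simp add: topology_inverse')
qed

lemma eventually_in_N: "i \<in> I \<Longrightarrow> \<forall>\<^sub>F x in D i. x \<in> N"
  using D_le_principal by (simp add: le_principal)

lemma eventually_notin_finite: "i \<in> I \<Longrightarrow> finite C \<Longrightarrow> \<forall>\<^sub>F x in D i. x \<notin> C"
  by (rule filter_leD[OF D_le_cofinite]) (simp_all add: eventually_cofinite)

lemma topspace_eq: "topspace X = insert z (N \<union> I)"
proof
  show "topspace X \<subseteq> insert z (N \<union> I)"
    using openin_topspace[of X] unfolding openin_iff by blast
  have "\<forall>\<^sub>F x in D i. x \<in> insert z (N \<union> I)" if "i \<in> I" for i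
    using eventually_in_N[OF that] by (rule eventually_mono) simp
  moreover have "finite (I - insert z (N \<union> I))" by (rule finite_subset[of _ "{}"]) auto
  ultimately have "openin X (insert z (N \<union> I))" unfolding openin_iff by blast
  then show "insert z (N \<union> I) \<subseteq> topspace X" by (rule openin_subset)
qed

lemma openin_isolated: "x \<in> N \<Longrightarrow> openin X {x}"
  unfolding openin_iff using disjoint by blast

lemma openin_basic:
  assumes "i \<in> I" "\<forall>\<^sub>F x in D i. x \<in> A"
  shows "openin X (insert i (A \<inter> N))"
proof -
  have "\<forall>\<^sub>F x in D i. x \<in> insert i (A \<inter> N)"
    using assms(2) eventually_in_N[OF assms(1)] by eventually_elim simp
  then show ?thesis unfolding openin_iff using disjoint assms(1) by auto
qed

lemma openin_diff_singleton: "openin X (topspace X - {x})"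
proof -
  have "\<forall>\<^sub>F y in D i. y \<in> topspace X - {x}" if "i \<in> I" for i
    using eventually_in_N[OF that] eventually_notin_finite[OF that, of "{x}", simplified]
    by eventually_elim (simp add: topspace_eq)
  moreover have "finite (I - (topspace X - {x}))"
    by (rule finite_subset[of _ "{x}"]) (auto simp: topspace_eq)
  ultimately show ?thesis
    unfolding openin_iff by (auto simp: topspace_eq)
qed

lemma openin_diff_convergent:
  assumes i: "i \<in> I" and C: "C \<subseteq> N" "almost_contained C (D i)"
  shows "openin X (topspace X - insert i C)"
proof -
  have "\<forall>\<^sub>F x in D j. x \<in> topspace X - insert i C" if j: "j \<in> I" "j \<noteq> i" for j
  proof -
    obtain A where A: "\<forall>\<^sub>F x in D j. x \<notin> A" "\<forall>\<^sub>F x in D i. x \<in> A"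
      using D_disjoint[OF j(1) i j(2)] unfolding inf_eq_bot_iff by blast
    then have "finite (C - A)" using C(2) unfolding almost_contained_def by blast
    from eventually_notin_finite[OF j(1) this] A(1) eventually_in_N[OF j(1)]
    show ?thesis
      by eventually_elim (use i disjoint in \<open>auto simp: topspace_eq\<close>)
  qed
  moreover have "I - (topspace X - insert i C) = {i}"
    using i C(1) disjoint unfolding topspace_eq by blast
  ultimately show ?thesis
    unfolding openin_iff by (auto simp: topspace_eq)
qed

lemma separable: "separable_space X"
  unfolding separable_space_def
proof (intro exI conjI)
  show "countable (insert z N)" using countable_N by simp
  show "insert z N \<subseteq> topspace X" by (auto simp: topspace_eq)
  have "\<exists>y\<in>insert z N. y \<in> U" if x: "x \<in> topspace X" and U: "x \<in> U" "openin X U" for x U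
  proof (cases "x \<in> I")
    case True
    then have "\<forall>\<^sub>F y in D x. y \<in> U" using U unfolding openin_iff by blast
    with eventually_in_N[OF True] have "\<forall>\<^sub>F y in D x. y \<in> N \<and> y \<in> U" by eventually_elim simp
    then show ?thesis using eventually_happens' D_neq_bot[OF True] by blast
  next
    case False
    then show ?thesis using x U unfolding topspace_eq by blast
  qed
  then show "X closure_of insert z N = topspace X"
    by (intro equalityI closure_of_subset_topspace subsetI) (unfold in_closure_of, blast)
qed

lemma limitin_eventually_neq:
  assumes "limitin X f b F" "x \<noteq> b"
  shows "\<forall>\<^sub>F a in F. f a \<noteq> x"
proof -
  have "b \<in> topspace X - {x}" using assms limitin_topspace by fastforce
  then have "\<forall>\<^sub>F a in F. f a \<in> topspace X - {x}"
    by (rule limitinD[OF assms(1) openin_diff_singleton])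
  then show ?thesis by (rule eventually_mono) simp
qed

lemma limitin_in_I_iff:
  assumes "i \<in> I" "\<forall>\<^sub>F a in F. f a \<in> N"
  shows "limitin X f i F \<longleftrightarrow> filtermap f F \<le> D i"
proof
  assume lim: "limitin X f i F"
  show "filtermap f F \<le> D i"
  proof (rule filter_leI)
    fix P assume "eventually P (D i)"
    then have "openin X (insert i (Collect P \<inter> N))" using assms(1) by (intro openin_basic) simp_all
    then have "\<forall>\<^sub>F a in F. f a \<in> insert i (Collect P \<inter> N)" by (rule limitinD[OF lim]) simp
    with assms(2) have "\<forall>\<^sub>F a in F. P (f a)"
      by eventually_elim (use assms(1) disjoint in auto)
    then show "eventually P (filtermap f F)" by (simp add: eventually_filtermap)
  qed
next
  assume filtermap_le: "filtermap f F \<le> D i"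
  show "limitin X f i F"
    unfolding limitin_def
  proof (intro conjI allI impI)
    show "i \<in> topspace X" using assms(1) by (simp add: topspace_eq)
    fix U assume "openin X U \<and> i \<in> U"
    then have "\<forall>\<^sub>F x in D i. x \<in> U" using assms(1) unfolding openin_iff by blast
    with filtermap_le have "\<forall>\<^sub>F x in filtermap f F. x \<in> U" by (rule filter_leD)
    then show "\<forall>\<^sub>F a in F. f a \<in> U" by (simp add: eventually_filtermap)
  qed
qed

lemma limitin_z_if_finite_to_one:
  assumes "filterlim f cofinite F" "\<forall>\<^sub>F a in F. f a \<in> insert z I"
  shows "limitin X f z F"
  unfolding limitin_def
proof (intro conjI allI impI)
  show "z \<in> topspace X" by (simp add: topspace_eq)
  fix U assume U: "openin X U \<and> z \<in> U"
  then have "finite (I - U)" unfolding openin_iff by blast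
  then have "\<forall>\<^sub>F x in cofinite. x \<notin> I - U" by (simp add: eventually_cofinite set_diff_eq)
  then have "\<forall>\<^sub>F a in F. f a \<notin> I - U" using assms(1) unfolding filterlim_iff by blast
  with assms(2) show "\<forall>\<^sub>F a in F. f a \<in> U" by eventually_elim (use U in auto)
qed

lemma limitin_z_eventually_notin_convergent:
  assumes "limitin X f z F" "i \<in> I" "C \<subseteq> N" "almost_contained C (D i)"
  shows "\<forall>\<^sub>F a in F. f a \<notin> C"
proof -
  have "z \<in> topspace X - insert i C" using assms(2,3) disjoint by (auto simp: topspace_eq)
  then have "\<forall>\<^sub>F a in F. f a \<in> topspace X - insert i C"
    by (rule limitinD[OF assms(1) openin_diff_convergent[OF assms(2-4)]])
  then show ?thesis by (rule eventually_mono) simp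
qed

lemma distinct_limits_notin_N:
  assumes "limitin X f a F" "limitin X f b F" "a \<noteq> b" "F \<noteq> bot"
  shows "a \<notin> N"
proof
  assume "a \<in> N"
  then have "\<forall>\<^sub>F x in F. f x \<in> {a}"
    by (intro limitinD[OF assms(1)] openin_isolated) simp_all
  with limitin_eventually_neq[OF assms(2,3)] have "\<forall>\<^sub>F x in F. False"
    by eventually_elim simp
  with assms(4) show False by (simp add: eventually_False)
qed

lemma distinct_limits_filtermap_le:
  assumes "limitin X f i F" "limitin X f b F" "i \<noteq> b" "i \<in> I"
  shows "\<forall>\<^sub>F a in F. f a \<in> N" "filtermap f F \<le> D i"
proof -
  have "openin X (insert i (UNIV \<inter> N))" using assms(4) by (intro openin_basic) simp_all
  then have "\<forall>\<^sub>F a in F. f a \<in> insert i N" by (intro limitinD[OF assms(1)]) simp_all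
  with limitin_eventually_neq[OF assms(2,3)] show N: "\<forall>\<^sub>F a in F. f a \<in> N"
    by eventually_elim simp
  show "filtermap f F \<le> D i" using assms(1) limitin_in_I_iff[OF assms(4) N] by blast
qed

lemma sequence_limit_in_I_not_z:
  assumes "limitin X s i sequentially" "i \<in> I"
  shows "\<not> limitin X s z sequentially"
proof
  assume z: "limitin X s z sequentially"
  have "i \<noteq> z" using assms(2) disjoint by blast
  note i = distinct_limits_filtermap_le[OF assms(1) z this assms(2)]
  have "almost_contained (range s \<inter> N) (filtermap s sequentially)"
    unfolding almost_contained_def
  proof (intro allI impI)
    fix A assume "\<forall>\<^sub>F x in filtermap s sequentially. x \<in> A"
    then have "finite {n. s n \<notin> A}"
      by (simp add: eventually_filtermap cofinite_eq_sequentially[symmetric] eventually_cofinite)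
    then show "finite (range s \<inter> N - A)"
      by (rule finite_surj[of _ _ s]) blast
  qed
  then have "almost_contained (range s \<inter> N) (D i)" using i(2) by (rule almost_contained_mono)
  then have "\<forall>\<^sub>F n in sequentially. s n \<notin> range s \<inter> N"
    using limitin_z_eventually_notin_convergent[OF z assms(2)] by blast
  with i(1) have "\<forall>\<^sub>F n in sequentially. False" by eventually_elim simp
  then show False by simp
qed

lemma unique_limits: "unique_sequential_limits X"
  unfolding unique_sequential_limits_def
proof (intro allI impI, elim conjE, rule ccontr)
  fix s a b assume lim: "limitin X s a sequentially" "limitin X s b sequentially" and "a \<noteq> b"
  have "a \<notin> N" "b \<notin> N"
    using distinct_limits_notin_N lim \<open>a \<noteq> b\<close> sequentially_bot by metis+
  then have "a \<in> insert z I" "b \<in> insert z I"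
    using limitin_topspace[OF lim(1)] limitin_topspace[OF lim(2)] by (auto simp: topspace_eq)
  then have I: "a \<in> I" "b \<in> I"
    using sequence_limit_in_I_not_z lim \<open>a \<noteq> b\<close> by blast+
  have "filtermap s sequentially \<le> inf (D a) (D b)"
    using distinct_limits_filtermap_le(2)[OF lim \<open>a \<noteq> b\<close> I(1)]
      distinct_limits_filtermap_le(2)[OF lim(2,1) \<open>a \<noteq> b\<close>[symmetric] I(2)]
    by (rule inf_greatest)
  then show False
    using D_disjoint[OF I \<open>a \<noteq> b\<close>] by (simp add: bot_unique filtermap_bot_iff)
qed

end

section \<open>The construction under the Continuum Hypothesis\<close>

text \<open>
  The conditions on the neighbourhood filter of an added point: \<open>\<G>\<close> will consist of the image
  filters of \<open>\<rho>\<^sub>2\<close>, whose convergence has to be prevented.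
\<close>

definition admissible :: "'x set \<Rightarrow> 'x filter set \<Rightarrow> 'x filter \<Rightarrow> bool" where
  "admissible N \<G> D \<longleftrightarrow> countably_generated D \<and> D \<noteq> bot \<and> D \<le> principal N \<and> D \<le> cofinite \<and>
     (\<forall>G\<in>\<G>. \<not> G \<le> D)"

context weak_P_plus_small_accretions
begin

lemma new_admissible_filter:
  assumes h: "h \<in> \<Lambda> \<rightarrow> N" "nowhere_constant h" and N: "countable N"
    and E: "E \<in> \<F>" "\<forall>G\<in>\<G>. \<not> G \<le> filtermap h (tails E)"
    and \<Q>: "countable \<Q>" "\<forall>D\<in>\<Q>. countably_generated D" "\<forall>D\<in>\<Q>. \<not> convergent_to h D"
  obtains D where "admissible N \<G> D" "convergent_to h D" "\<forall>D'\<in>\<Q>. inf D D' = bot"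
proof -
  let ?\<Q> = "\<Q> \<union> (\<lambda>x. principal {x}) ` N"
  have "countable ?\<Q>" "\<forall>D\<in>?\<Q>. countably_generated D"
    using \<Q>(1,2) N countably_generated_principal by auto
  moreover have "\<forall>F\<in>\<F>. \<forall>D\<in>?\<Q>. \<not> filtermap h (tails F) \<le> D"
    using \<Q>(3) nowhere_constant_not_convergent_to_point[OF h(2)]
    unfolding convergent_to_def by blast
  ultimately obtain F where F: "F \<in> \<F>" "tails F \<le> tails E"
    "\<forall>D\<in>?\<Q>. inf (filtermap h (tails F)) D = bot"
    by (rule tail_refinement_disjoint_from_filters[OF E(1)])
  let ?D = "filtermap h (tails F)"
  have le_N: "?D \<le> principal N" using F(1) h(1) by (rule filtermap_tails_le_principal)
  then have "?D \<le> cofinite" by (rule le_cofinite_if_disjoint_from_points) (use F(3) in simp)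
  moreover have "?D \<noteq> bot"
    using all_members_infinite_neq_bot[OF all_members_infinite_tails[OF F(1)]]
    by (simp add: filtermap_bot_iff)
  moreover have "\<forall>G\<in>\<G>. \<not> G \<le> ?D"
    using E(2) filtermap_mono[OF F(2)] by (blast intro: order_trans)
  ultimately have "admissible N \<G> ?D"
    unfolding admissible_def using countably_generated_filtermap_tails[OF F(1)] le_N by blast
  moreover have "convergent_to h ?D" using F(1) unfolding convergent_to_def by blast
  ultimately show thesis using F(3) that by blast
qed

lemma old_or_new_admissible_filter:
  assumes h: "h \<in> \<Lambda> \<rightarrow> N" "nowhere_constant h" and N: "countable N"
    and E: "E \<in> \<F>" "\<forall>G\<in>\<G>. \<not> G \<le> filtermap h (tails E)"
    and \<Q>: "countable \<Q>" "\<forall>D\<in>\<Q>. admissible N \<G> D"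
  shows "\<exists>D. admissible N \<G> D \<and> convergent_to h D \<and> (D \<in> \<Q> \<or> (\<forall>D'\<in>\<Q>. inf D D' = bot))"
proof (cases "\<exists>D\<in>\<Q>. convergent_to h D")
  case True
  then show ?thesis using \<Q>(2) by blast
next
  case False
  have "\<forall>D\<in>\<Q>. countably_generated D" using \<Q>(2) unfolding admissible_def by blast
  then obtain D where "admissible N \<G> D" "convergent_to h D" "\<forall>D'\<in>\<Q>. inf D D' = bot"
    using new_admissible_filter[OF h N E \<Q>(1)] False by blast
  then show ?thesis by blast
qed

lemma exists_admissible_family:
  fixes N :: "'x set"
  assumes CH: continuum_hypothesis and N: "countable N"
    and avoid: "\<forall>h\<in>\<Lambda> \<rightarrow> N. \<exists>E\<in>\<F>. \<forall>G\<in>\<G>. \<not> G \<le> filtermap h (tails E)"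
  obtains \<Q> where "\<Q> \<lesssim> (UNIV :: real set)" "\<forall>D\<in>\<Q>. admissible N \<G> D"
    "pairwise (\<lambda>D D'. inf D D' = bot) \<Q>"
    "\<forall>h\<in>\<Lambda> \<rightarrow> N. nowhere_constant h \<longrightarrow> (\<exists>D\<in>\<Q>. convergent_to h D)"
proof -
  let ?S = "{h \<in> \<Lambda> \<rightarrow>\<^sub>E N. nowhere_constant h}"
  have "?S \<lesssim> (\<Lambda> \<rightarrow>\<^sub>E N)" by (rule subset_imp_lepoll) blast
  then have S: "?S \<lesssim> (UNIV :: real set)"
    using countable_functions_lepoll_real[OF countable_\<Lambda> N] by (rule lepoll_trans)
  have symp: "symp (\<lambda>D D' :: 'x filter. inf D D' = bot)"
    by (intro sympI) (simp add: inf_commute)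
  have step: "\<exists>D. admissible N \<G> D \<and> convergent_to h D \<and> (D \<in> \<Q> \<or> (\<forall>D'\<in>\<Q>. inf D D' = bot))"
    if h: "h \<in> ?S" and \<Q>: "countable \<Q>" "\<forall>D\<in>\<Q>. admissible N \<G> D" for h \<Q>
  proof -
    have h': "h \<in> \<Lambda> \<rightarrow> N" "nowhere_constant h" using h by auto
    then obtain E where "E \<in> \<F>" "\<forall>G\<in>\<G>. \<not> G \<le> filtermap h (tails E)" using avoid by blast
    with h' show ?thesis by (rule old_or_new_admissible_filter[OF _ _ N _ _ \<Q>])
  qed
  obtain \<Q> where \<Q>: "\<Q> \<lesssim> (UNIV :: real set)" "\<forall>D\<in>\<Q>. admissible N \<G> D"
    "pairwise (\<lambda>D D'. inf D D' = bot) \<Q>" "\<forall>h\<in>?S. \<exists>D\<in>\<Q>. convergent_to h D"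
    by (rule continuum_hypothesis_greedy_family[OF CH S symp,
          of "admissible N \<G>" "\<lambda>D h. convergent_to h D", OF step])
  have "\<exists>D\<in>\<Q>. convergent_to h D" if "h \<in> \<Lambda> \<rightarrow> N" "nowhere_constant h" for h
  proof -
    have "restrict h \<Lambda> \<in> ?S"
      using that by (simp add: restrict_PiE_iff Pi_iff nowhere_constant_restrict)
    with \<Q>(4) show ?thesis by (metis convergent_to_restrict)
  qed
  then show thesis using that[OF \<Q>(1-3)] by blast
qed

end

locale capturing_limit_points_space =
  weak_P_plus_small_accretions \<Lambda> \<Omega> \<F> \<rho> + limit_points_space N I z D
  for \<Lambda> :: "'l set" and \<Omega> :: "'o set" and \<F> and \<rho>
    and N I :: "'x set" and z :: 'x and D :: "'x \<Rightarrow> 'x filter" +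
  assumes captures: "h \<in> \<Lambda> \<rightarrow> N \<Longrightarrow> nowhere_constant h \<Longrightarrow> \<exists>i\<in>I. convergent_to h (D i)"
    and N_nonempty: "N \<noteq> {}"
begin

lemma limitin_if_constant:
  assumes "F \<in> \<F>" "f ` \<rho> F \<subseteq> {x}" "f \<in> \<Lambda> \<rightarrow> topspace X"
  shows "limitin X f x (tails F)"
proof (rule limitin_eventually)
  obtain a where "a \<in> \<rho> F" using infinite_\<rho>[OF assms(1)] by fastforce
  then show "x \<in> topspace X" using assms \<rho>_subset[OF assms(1)] by blast
  show "\<forall>\<^sub>F a in tails F. f a = x"
    using eventually_in_\<rho> by (rule eventually_mono) (use assms(2) in blast)
qed

lemma exists_limit_of_map_into_N:
  assumes h: "h \<in> \<Lambda> \<rightarrow> N"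
  shows "\<exists>F\<in>\<F>. \<exists>x. limitin X h x (tails F)"
proof (cases "nowhere_constant h")
  case True
  obtain i F where F: "i \<in> I" "F \<in> \<F>" "filtermap h (tails F) \<le> D i"
    using captures[OF h True] unfolding convergent_to_def by blast
  have "\<forall>\<^sub>F a in tails F. h a \<in> N"
    using filtermap_tails_le_principal[OF F(2) h] by (simp add: le_principal eventually_filtermap)
  then have "limitin X h i (tails F)" using F limitin_in_I_iff[OF F(1)] by blast
  with F(2) show ?thesis by blast
next
  case False
  then obtain F x where "F \<in> \<F>" "h ` \<rho> F \<subseteq> {x}" unfolding nowhere_constant_def by blast
  moreover have "h \<in> \<Lambda> \<rightarrow> topspace X" using h by (auto simp: topspace_eq)
  ultimately show ?thesis using limitin_if_constant by blast
qed

lemma exists_limit_of_map_into_complement_N: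
  assumes f: "f \<in> \<Lambda> \<rightarrow> topspace X" and positive: "ideal_positive (\<Lambda> - f -` N)"
  shows "\<exists>F\<in>\<F>. \<exists>x. limitin X f x (tails F)"
proof -
  obtain F where F: "F \<in> \<F>" "\<rho> F \<subseteq> \<Lambda> - f -` N"
    "(\<exists>x. f ` \<rho> F \<subseteq> {x}) \<or> filterlim f cofinite (tails F)"
    using constant_or_finite_to_one[OF positive, of f] by blast
  from F(3) show ?thesis
  proof
    assume "\<exists>x. f ` \<rho> F \<subseteq> {x}"
    then show ?thesis using limitin_if_constant F(1) f by blast
  next
    assume "filterlim f cofinite (tails F)"
    moreover have "\<forall>\<^sub>F a in tails F. f a \<in> insert z I"
      using eventually_in_\<rho>
    proof (rule eventually_mono)
      fix a assume "a \<in> \<rho> F"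
      then show "f a \<in> insert z I" using F(2) f unfolding topspace_eq by blast
    qed
    ultimately show ?thesis using F(1) limitin_z_if_finite_to_one by blast
  qed
qed

lemma in_FinBW: "X \<in> FinBW \<Lambda> \<Omega> \<F> \<rho>"
  unfolding FinBW_iff_limitin
proof
  fix f assume f: "f \<in> \<Lambda> \<rightarrow> topspace X"
  show "\<exists>F\<in>\<F>. \<exists>x. limitin X f x (tails F)"
  proof (cases "ideal_positive (\<Lambda> - f -` N)")
    case True
    with f show ?thesis by (rule exists_limit_of_map_into_complement_N)
  next
    case False
    obtain y where "y \<in> N" using N_nonempty by blast
    define h where "h a = (if f a \<in> N then f a else y)" for a
    have "h \<in> \<Lambda> \<rightarrow> N" using \<open>y \<in> N\<close> by (simp add: h_def)
    then obtain E x where E: "E \<in> \<F>" "limitin X h x (tails E)"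
      using exists_limit_of_map_into_N by blast
    obtain F where F: "F \<in> \<F>" "tails F \<le> tails E" "\<forall>\<^sub>F a in tails F. a \<in> f -` N"
      using tail_refinement_into[OF E(1) False] .
    have "\<forall>\<^sub>F a in tails F. h a = f a"
      using F(3) by (rule eventually_mono) (simp add: h_def)
    then have "limitin X f x (tails F)"
      using limitin_mono[OF E(2) F(2)] by (rule limitin_transform_eventually)
    with F(1) show ?thesis by blast
  qed
qed

lemma infinite_subset_converges:
  assumes "infinite B" "B \<subseteq> N"
  obtains i C where "i \<in> I" "C \<subseteq> B" "infinite C" "almost_contained C (D i)"
proof -
  have "\<Lambda> \<lesssim> (UNIV :: nat set)" using countable_\<Lambda> unfolding countable_def lepoll_def by blast
  also have "(UNIV :: nat set) \<lesssim> B" using assms(1) by (simp add: infinite_le_lepoll)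
  finally obtain h where h: "inj_on h \<Lambda>" "h ` \<Lambda> \<subseteq> B" unfolding lepoll_def by blast
  have "infinite (h ` \<rho> F)" if "F \<in> \<F>" for F
    using infinite_\<rho>[OF that] inj_on_subset[OF h(1) \<rho>_subset[OF that]] by (simp add: finite_image_iff)
  then have "nowhere_constant h"
    unfolding nowhere_constant_def by (meson finite.simps finite_subset)
  moreover have "h \<in> \<Lambda> \<rightarrow> N" using h(2) assms(2) by blast
  ultimately obtain i F where F: "i \<in> I" "F \<in> \<F>" "filtermap h (tails F) \<le> D i"
    using captures unfolding convergent_to_def by blast
  let ?H = "filtermap h (tails F)"
  have "h \<in> \<Lambda> \<rightarrow> B" using h(2) by blast
  with F(2) have "\<forall>\<^sub>F x in ?H. x \<in> B"
    unfolding le_principal[symmetric] by (rule filtermap_tails_le_principal)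
  then obtain C where C: "infinite C" "C \<subseteq> B" "almost_contained C ?H"
    by (rule infinite_almost_contained_set_exists[OF countably_generated_filtermap_tails[OF F(2)]
          all_members_infinite_filtermap_tails[OF F(2) h(1)]])
  show thesis using F(1) C(2,1) almost_contained_mono[OF C(3) F(3)] by (rule that)
qed

lemma not_limitin_z:
  assumes G: "countably_generated G" "all_members_infinite G" "G \<le> principal N"
  shows "\<not> limitin X (\<lambda>x. x) z G"
proof
  assume z: "limitin X (\<lambda>x. x) z G"
  have "\<forall>\<^sub>F x in G. x \<in> N" using G(3) by (simp add: le_principal)
  then obtain B where B: "infinite B" "B \<subseteq> N" "almost_contained B G"
    using infinite_almost_contained_set_exists[OF G(1,2)] by blast
  obtain i C where C: "i \<in> I" "C \<subseteq> B" "infinite C" "almost_contained C (D i)"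
    using infinite_subset_converges[OF B(1,2)] .
  have "C \<subseteq> N" using C(2) B(2) by blast
  then have "\<forall>\<^sub>F x in G. x \<in> - C"
    using limitin_z_eventually_notin_convergent[OF z C(1) _ C(4)] by simp
  then have "finite (B - - C)" using B(3) unfolding almost_contained_def by blast
  moreover have "B - - C = C" using C(2) by blast
  ultimately show False using C(3) by simp
qed

lemma not_limitin_if_not_le:
  assumes G: "countably_generated G" "all_members_infinite G" "G \<le> principal N"
    and not_le: "\<forall>i\<in>I. \<not> G \<le> D i"
  shows "\<not> limitin X (\<lambda>x. x) x G"
proof
  assume lim: "limitin X (\<lambda>x. x) x G"
  then have "x \<in> insert z (N \<union> I)" using limitin_topspace topspace_eq by metis
  then consider "x \<in> N" | "x \<in> I" | "x = z" by blast
  then show False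
  proof cases
    case 1
    then have "\<forall>\<^sub>F y in G. y \<in> {x}" by (intro limitinD[OF lim] openin_isolated) simp_all
    then show False using G(2) unfolding all_members_infinite_def by blast
  next
    case 2
    have "\<forall>\<^sub>F y in G. y \<in> N" using G(3) by (simp add: le_principal)
    then have "filtermap (\<lambda>y. y) G \<le> D x"
      using limitin_in_I_iff[OF 2, of "\<lambda>y. y"] lim by blast
    then show False using not_le 2 by simp
  next
    case 3
    with lim not_limitin_z[OF G] show False by blast
  qed
qed

end

lemma (in weak_P_plus_small_accretions) exists_capturing_space:
  fixes N P :: "'x set" and z :: 'x
  assumes CH: continuum_hypothesis and N: "countable N" "N \<noteq> {}"
    and P: "(UNIV :: real set) \<lesssim> P" "N \<inter> P = {}" "z \<notin> N" "z \<notin> P"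
    and avoid: "\<forall>h\<in>\<Lambda> \<rightarrow> N. \<exists>E\<in>\<F>. \<forall>G\<in>\<G>. \<not> G \<le> filtermap h (tails E)"
  obtains I D where "capturing_limit_points_space \<Lambda> \<Omega> \<F> \<rho> N I z D"
    "\<forall>i\<in>I. \<forall>G\<in>\<G>. \<not> G \<le> D i"
proof -
  obtain \<Q> where \<Q>: "\<Q> \<lesssim> (UNIV :: real set)" "\<forall>D\<in>\<Q>. admissible N \<G> D"
    "pairwise (\<lambda>D D'. inf D D' = bot) \<Q>"
    "\<forall>h\<in>\<Lambda> \<rightarrow> N. nowhere_constant h \<longrightarrow> (\<exists>D\<in>\<Q>. convergent_to h D)"
    using exists_admissible_family[OF CH N(1) avoid] .
  obtain p where p: "inj_on p \<Q>" "p ` \<Q> \<subseteq> P"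
    using lepoll_trans[OF \<Q>(1) P(1)] unfolding lepoll_def by blast
  define I and D where "I = p ` \<Q>" and "D = inv_into \<Q> p"
  have D: "D i \<in> \<Q>" if "i \<in> I" for i
    using that unfolding I_def D_def by (rule inv_into_into)
  have D_p: "D (p d) = d" "p d \<in> I" if "d \<in> \<Q>" for d
    using that p(1) by (simp_all add: I_def D_def)
  have "inj_on D I" unfolding D_def I_def by (rule inj_on_inv_into) simp
  have "capturing_limit_points_space \<Lambda> \<Omega> \<F> \<rho> N I z D"
  proof
    show "N \<inter> I = {}" "z \<notin> N" "z \<notin> I" using P p(2) unfolding I_def by blast+
    show "inf (D i) (D j) = bot" if "i \<in> I" "j \<in> I" "i \<noteq> j" for i j
      using that D \<open>inj_on D I\<close> \<Q>(3) by (meson inj_onD pairwiseD)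
    show "\<exists>i\<in>I. convergent_to h (D i)" if "h \<in> \<Lambda> \<rightarrow> N" "nowhere_constant h" for h
      using \<Q>(4) that D_p by metis
  qed (use N \<Q>(2) D in \<open>auto simp: admissible_def\<close>)
  moreover have "\<forall>i\<in>I. \<forall>G\<in>\<G>. \<not> G \<le> D i" using \<Q>(2) D unfolding admissible_def by blast
  ultimately show thesis by (rule that)
qed

lemma exists_separating_space:
  assumes CH: continuum_hypothesis
    and \<rho>\<^sub>1: "weak_P_plus_small_accretions \<Lambda>\<^sub>1 \<Omega>\<^sub>1 \<F>\<^sub>1 \<rho>\<^sub>1" and \<rho>\<^sub>2: "partition_regular \<Lambda>\<^sub>2 \<Omega>\<^sub>2 \<F>\<^sub>2 \<rho>\<^sub>2"
    and not_le: "\<not> katetov_le \<Lambda>\<^sub>2 \<Omega>\<^sub>2 \<F>\<^sub>2 \<rho>\<^sub>2 \<Lambda>\<^sub>1 \<Omega>\<^sub>1 \<F>\<^sub>1 \<rho>\<^sub>1"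
  obtains X :: "real topology" where "separable_space X" "unique_sequential_limits X"
    "X \<in> FinBW \<Lambda>\<^sub>1 \<Omega>\<^sub>1 \<F>\<^sub>1 \<rho>\<^sub>1" "X \<notin> FinBW \<Lambda>\<^sub>2 \<Omega>\<^sub>2 \<F>\<^sub>2 \<rho>\<^sub>2"
proof -
  interpret \<rho>\<^sub>1: weak_P_plus_small_accretions \<Lambda>\<^sub>1 \<Omega>\<^sub>1 \<F>\<^sub>1 \<rho>\<^sub>1 by fact
  interpret \<rho>\<^sub>2: partition_regular_function \<Lambda>\<^sub>2 \<Omega>\<^sub>2 \<F>\<^sub>2 \<rho>\<^sub>2 by unfold_locales fact
  interpret partition_regular_pair \<Lambda>\<^sub>1 \<Omega>\<^sub>1 \<F>\<^sub>1 \<rho>\<^sub>1 \<Lambda>\<^sub>2 \<Omega>\<^sub>2 \<F>\<^sub>2 \<rho>\<^sub>2 ..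
  define e where "e b = - 1 - real (to_nat_on \<Lambda>\<^sub>2 b)" for b
  have e: "inj_on e \<Lambda>\<^sub>2"
    using \<rho>\<^sub>2.countable_\<Lambda> by (intro inj_onI) (simp add: e_def)
  let ?N = "e ` \<Lambda>\<^sub>2" and ?\<G> = "(\<lambda>F. filtermap e (\<rho>\<^sub>2.tails F)) ` \<F>\<^sub>2"
  have N: "countable ?N" "?N \<noteq> {}"
    using \<rho>\<^sub>2.countable_\<Lambda> \<rho>\<^sub>2.infinite_\<Lambda> by auto
  have "(UNIV :: real set) \<lesssim> {0 :: real<..}"
    unfolding lepoll_def by (intro exI[of _ exp]) (auto simp: inj_on_def)
  moreover have "?N \<inter> {0<..} = {}" "0 \<notin> ?N" "0 \<notin> {0::real<..}"
    unfolding e_def by auto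
  moreover have "\<forall>h\<in>\<Lambda>\<^sub>1 \<rightarrow> ?N. \<exists>E\<in>\<F>\<^sub>1. \<forall>G\<in>?\<G>. \<not> G \<le> filtermap h (\<rho>\<^sub>1.tails E)"
    using filtermap_tails_not_le_if_not_katetov_le[OF not_le e] by simp
  ultimately obtain I D where "capturing_limit_points_space \<Lambda>\<^sub>1 \<Omega>\<^sub>1 \<F>\<^sub>1 \<rho>\<^sub>1 ?N I 0 D"
    and D: "\<forall>i\<in>I. \<forall>G\<in>?\<G>. \<not> G \<le> D i"
    by (rule \<rho>\<^sub>1.exists_capturing_space[OF CH N])
  then interpret S: capturing_limit_points_space \<Lambda>\<^sub>1 \<Omega>\<^sub>1 \<F>\<^sub>1 \<rho>\<^sub>1 ?N I 0 D by simp
  have "\<not> limitin S.X e x (\<rho>\<^sub>2.tails F)" if F: "F \<in> \<F>\<^sub>2" for F x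
  proof -
    let ?G = "filtermap e (\<rho>\<^sub>2.tails F)"
    have "?G \<le> principal ?N" using F by (intro \<rho>\<^sub>2.filtermap_tails_le_principal) auto
    moreover have "\<forall>i\<in>I. \<not> ?G \<le> D i" using D F by blast
    ultimately have "\<not> limitin S.X (\<lambda>y. y) x ?G"
      by (rule S.not_limitin_if_not_le[OF \<rho>\<^sub>2.countably_generated_filtermap_tails[OF F]
            \<rho>\<^sub>2.all_members_infinite_filtermap_tails[OF F e]])
    then show ?thesis by (simp add: limitin_filtermap)
  qed
  moreover have "e \<in> \<Lambda>\<^sub>2 \<rightarrow> topspace S.X" by (simp add: S.topspace_eq)
  ultimately have "S.X \<notin> FinBW \<Lambda>\<^sub>2 \<Omega>\<^sub>2 \<F>\<^sub>2 \<rho>\<^sub>2" unfolding \<rho>\<^sub>2.FinBW_iff_limitin by blast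
  with S.separable S.unique_limits S.in_FinBW show thesis by (rule that)
qed

theorem theorem17p2:
  fixes \<Lambda>\<^sub>1 :: "'l1 set" and \<Omega>\<^sub>1 :: "'o1 set" and \<F>\<^sub>1 :: "'o1 set set"
    and \<rho>\<^sub>1 :: "'o1 set \<Rightarrow> 'l1 set"
    and \<Lambda>\<^sub>2 :: "'l2 set" and \<Omega>\<^sub>2 :: "'o2 set" and \<F>\<^sub>2 :: "'o2 set set"
    and \<rho>\<^sub>2 :: "'o2 set \<Rightarrow> 'l2 set"
  assumes "continuum_hypothesis"
    and "partition_regular \<Lambda>\<^sub>1 \<Omega>\<^sub>1 \<F>\<^sub>1 \<rho>\<^sub>1"
    and "partition_regular \<Lambda>\<^sub>2 \<Omega>\<^sub>2 \<F>\<^sub>2 \<rho>\<^sub>2"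
    and "weak_P_plus \<Omega>\<^sub>1 \<F>\<^sub>1 \<rho>\<^sub>1"
    and "has_small_accretions \<Lambda>\<^sub>1 \<Omega>\<^sub>1 \<F>\<^sub>1 \<rho>\<^sub>1"
  shows
    "(\<not> katetov_le \<Lambda>\<^sub>2 \<Omega>\<^sub>2 \<F>\<^sub>2 \<rho>\<^sub>2 \<Lambda>\<^sub>1 \<Omega>\<^sub>1 \<F>\<^sub>1 \<rho>\<^sub>1 \<longleftrightarrow>
        (\<exists>X :: real topology. separable_space X \<and> unique_sequential_limits X \<and>
           X \<in> FinBW \<Lambda>\<^sub>1 \<Omega>\<^sub>1 \<F>\<^sub>1 \<rho>\<^sub>1 - FinBW \<Lambda>\<^sub>2 \<Omega>\<^sub>2 \<F>\<^sub>2 \<rho>\<^sub>2)) \<and>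
     ((\<exists>X :: 'x topology. separable_space X \<and> unique_sequential_limits X \<and>
           X \<in> FinBW \<Lambda>\<^sub>1 \<Omega>\<^sub>1 \<F>\<^sub>1 \<rho>\<^sub>1 - FinBW \<Lambda>\<^sub>2 \<Omega>\<^sub>2 \<F>\<^sub>2 \<rho>\<^sub>2) \<longrightarrow>
        \<not> katetov_le \<Lambda>\<^sub>2 \<Omega>\<^sub>2 \<F>\<^sub>2 \<rho>\<^sub>2 \<Lambda>\<^sub>1 \<Omega>\<^sub>1 \<F>\<^sub>1 \<rho>\<^sub>1)"
proof -
  have \<rho>\<^sub>1: "weak_P_plus_small_accretions \<Lambda>\<^sub>1 \<Omega>\<^sub>1 \<F>\<^sub>1 \<rho>\<^sub>1"
    using assms by unfold_locales
  interpret partition_regular_pair \<Lambda>\<^sub>1 \<Omega>\<^sub>1 \<F>\<^sub>1 \<rho>\<^sub>1 \<Lambda>\<^sub>2 \<Omega>\<^sub>2 \<F>\<^sub>2 \<rho>\<^sub>2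
    using assms(2,3) by unfold_locales
  have "\<exists>X :: real topology. separable_space X \<and> unique_sequential_limits X \<and>
      X \<in> FinBW \<Lambda>\<^sub>1 \<Omega>\<^sub>1 \<F>\<^sub>1 \<rho>\<^sub>1 - FinBW \<Lambda>\<^sub>2 \<Omega>\<^sub>2 \<F>\<^sub>2 \<rho>\<^sub>2"
    if "\<not> katetov_le \<Lambda>\<^sub>2 \<Omega>\<^sub>2 \<F>\<^sub>2 \<rho>\<^sub>2 \<Lambda>\<^sub>1 \<Omega>\<^sub>1 \<F>\<^sub>1 \<rho>\<^sub>1"
    using exists_separating_space[OF assms(1) \<rho>\<^sub>1 assms(3) that] by blast
  then show ?thesis
    using FinBW_subset_if_katetov_le[where 'x = real] FinBW_subset_if_katetov_le[where 'x = 'x]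
    by blast
qed

end
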